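(* Let $g,h,c$ be integers with $h\ge0$, $c>0$ and $g=2h+c$. If $c=2t$ set $h_0:=t-1$ and $c_0:=2$; if $c=2t+1$ set $h_0:=t$ and $c_0:=1$. Then for every positive integer $k$: (1) every mixed surface grid of order $162^{2g}k$ with $c$ crosscaps and $h$ handles contains $\mathcal{D}^{(h+h_0,c_0)}_k$ as a minor; (2) $\mathcal{D}^{(h+h_0,c_0)}_{162^{2g}k}$ contains every mixed surface grid of order $k$ with $c$ crosscaps and $h$ handles as a minor. In particular, for every minor-monotone parametric graph $\mathcal{X}=\langle\mathcal{X}_k\rangle_{k\in\mathbb{N}}$ where each $\mathcal{X}_k$ is a mixed surface grid of order $k$ with $c$ crosscaps and $h$ handles, $\mathcal{X}$ and $\mathcal{D}^{(h+h_0,c_0)}=\langle\mathcal{D}^{(h+h_0,c_0)}_k\rangle_{k\in\mathbb{N}}$ are linearly equivalent.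
   Context: All graphs are finite, simple, undirected; $H\le G$ means $H$ is a minor of $G$. The $(m,n)$-cylindrical grid is the Cartesian product of a cycle on $n$ vertices and a path on $m$ vertices; it consists of disjoint cycles $C_1,\dots,C_m$, the vertices of $C_i$ being $v^i_1,\dots,v^i_n$ in cyclic order, such that $v^1_jv^2_j\cdots v^m_j$ is a path for every $j$. In the $(k,4kp)$-cylindrical grid, for a position $i\in[p]$ let $b=4k(i-1)$: adding a handle at position $i$ means adding the edges $v^1_{b+j}v^1_{b+3k-j+1}$ and $v^1_{b+k+j}v^1_{b+4k-j+1}$ for all $j\in[k]$; adding a crosscap at position $i$ means adding the edges $v^1_{b+j}v^1_{b+2k+j}$ for all $j\in[2k]$. A mixed surface grid of order $k$ with $c$ crosscaps and $h$ handles is obtained by choosing a partition $I_c, I_h$ of $[2,c+h+1]$ with $|I_c|=c$, $|I_h|=h$, and adding to the $(k,4k(c+h+1))$-cylindrical grid a crosscap at every position of $I_c$ and a handle at every position of $I_h$. The Dyck-grid $\mathcal{D}^{(h,c)}_k$ is the mixed surface grid of order $k$ with handles at positions $2,\dots,h+1$ and crosscaps at positions $h+2,\dots,h+c+1$. A parametric graph is a sequence $\langle\mathcal{H}_k\rangle_{k\in\mathbb{N}}$ of graphs; it is minor-monotone if $\mathcal{H}_k\le\mathcal{H}_{k+1}$ for all $k$. Two parametric graphs $\mathcal{H}^1,\mathcal{H}^2$ are linearly equivalent if there is a linear function $f$ with $\mathcal{H}^1_k\le\mathcal{H}^2_{f(k)}$ and $\mathcal{H}^2_k\le\mathcal{H}^1_{f(k)}$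 for all $k$. *)

theory Defs
  imports Main
begin

section \<open>Finite simple graphs and minors\<close>

record 'a ugraph =
  verts :: "'a set"
  edges :: "'a set set"

definition simple_graph :: "'a ugraph \<Rightarrow> bool" where
  "simple_graph G \<longleftrightarrow> finite (verts G) \<and> (\<forall>e\<in>edges G. e \<subseteq> verts G \<and> card e = 2)"

definition connected_in :: "'a ugraph \<Rightarrow> 'a set \<Rightarrow> bool" where
  "connected_in G S \<longleftrightarrow> S \<noteq> {} \<and> S \<subseteq> verts G \<and>
     (\<forall>x\<in>S. \<forall>y\<in>S. (x, y) \<in> {(u, v). u \<in> S \<and> v \<in> S \<and> {u, v} \<in> edges G}\<^sup>*)"

text \<open>The minor relation is given by branch sets, so it does not depend on vertex names,
  and the two graphs may have different vertex types.\<close>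

definition minor :: "'a ugraph \<Rightarrow> 'b ugraph \<Rightarrow> bool" (infix "\<preceq>" 50) where
  "H \<preceq> G \<longleftrightarrow> (\<exists>B.
     (\<forall>u\<in>verts H. connected_in G (B u)) \<and>
     (\<forall>u\<in>verts H. \<forall>v\<in>verts H. u \<noteq> v \<longrightarrow> B u \<inter> B v = {}) \<and>
     (\<forall>u v. {u, v} \<in> edges H \<longrightarrow> (\<exists>x\<in>B u. \<exists>y\<in>B v. {x, y} \<in> edges G)))"

section \<open>Cylindrical grids\<close>

definition path_graph :: "nat \<Rightarrow> nat ugraph" where
  "path_graph m = \<lparr>verts = {1..m}, edges = {{i, i + 1} | i. 1 \<le> i \<and> i < m}\<rparr>"

text \<open>This is a cycle only for \<open>n \<ge> 3\<close>. Below, \<open>n\<close> is a multiple of 4; for \<open>n = 0\<close> the graph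
  is empty.\<close>

definition cycle_graph :: "nat \<Rightarrow> nat ugraph" where
  "cycle_graph n = \<lparr>verts = {1..n}, edges = {{j, j mod n + 1} | j. 1 \<le> j \<and> j \<le> n}\<rparr>"

definition cartesian_product :: "'a ugraph \<Rightarrow> 'b ugraph \<Rightarrow> ('a \<times> 'b) ugraph" where
  "cartesian_product G H = \<lparr>verts = verts G \<times> verts H,
     edges = {{(x, y), (x, y')} | x y y'. x \<in> verts G \<and> {y, y'} \<in> edges H} \<union>
             {{(x, y), (x', y)} | x x' y. {x, x'} \<in> edges G \<and> y \<in> verts H}\<rparr>"

text \<open>The vertex \<open>v\<^sup>i\<^sub>j\<close> (position \<open>j\<close> on the cycle \<open>C\<^sub>i\<close>) is the pair \<open>(i, j)\<close>.\<close>

definition cylindrical_grid :: "nat \<Rightarrow> nat \<Rightarrow> (nat \<times> nat) ugraph" where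
  "cylindrical_grid m n = cartesian_product (path_graph m) (cycle_graph n)"

section \<open>Mixed surface grids and Dyck-grids\<close>

definition handle_edges :: "nat \<Rightarrow> nat \<Rightarrow> (nat \<times> nat) set set" where
  "handle_edges k i = (let b = 4 * k * (i - 1) in
     {{(1, b + j), (1, b + 3 * k - j + 1)} | j. 1 \<le> j \<and> j \<le> k} \<union>
     {{(1, b + k + j), (1, b + 4 * k - j + 1)} | j. 1 \<le> j \<and> j \<le> k})"

definition crosscap_edges :: "nat \<Rightarrow> nat \<Rightarrow> (nat \<times> nat) set set" where
  "crosscap_edges k i = (let b = 4 * k * (i - 1) in
     {{(1, b + j), (1, b + 2 * k + j)} | j. 1 \<le> j \<and> j \<le> 2 * k})"

definition surface_grid :: "nat \<Rightarrow> nat \<Rightarrow> nat set \<Rightarrow> nat set \<Rightarrow> (nat \<times> nat) ugraph" where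
  "surface_grid k p Ic Ih = (let G = cylindrical_grid k (4 * k * p) in
     \<lparr>verts = verts G,
      edges = edges G \<union> (\<Union>i\<in>Ic. crosscap_edges k i) \<union> (\<Union>i\<in>Ih. handle_edges k i)\<rparr>)"

text \<open>A part of the partition may be empty. For order \<open>k = 0\<close> the only such grid is the
  graph without vertices.\<close>

definition mixed_surface_grid :: "nat \<Rightarrow> nat \<Rightarrow> nat \<Rightarrow> (nat \<times> nat) ugraph \<Rightarrow> bool" where
  "mixed_surface_grid k c h G \<longleftrightarrow> (\<exists>Ic Ih.
     Ic \<union> Ih = {2..c + h + 1} \<and> Ic \<inter> Ih = {} \<and> card Ic = c \<and> card Ih = h \<and>
     G = surface_grid k (c + h + 1) Ic Ih)"

definition dyck_grid :: "nat \<Rightarrow> nat \<Rightarrow> nat \<Rightarrow> (nat \<times> nat) ugraph" where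
  "dyck_grid h c k = surface_grid k (c + h + 1) {h + 2..h + c + 1} {2..h + 1}"

section \<open>Parametric graphs\<close>

definition parametric_graph :: "(nat \<Rightarrow> 'a ugraph) \<Rightarrow> bool" where
  "parametric_graph X \<longleftrightarrow> (\<forall>k. simple_graph (X k))"

definition minor_monotone :: "(nat \<Rightarrow> 'a ugraph) \<Rightarrow> bool" where
  "minor_monotone X \<longleftrightarrow> (\<forall>k. X k \<preceq> X (k + 1))"

text \<open>Linear functions are taken without constant term. This is the stronger reading, since
  every such function is also affine.\<close>

definition linear_function :: "(nat \<Rightarrow> nat) \<Rightarrow> bool" where
  "linear_function f \<longleftrightarrow> (\<exists>a. \<forall>k. f k = a * k)"

definition linearly_equivalent :: "(nat \<Rightarrow> 'a ugraph) \<Rightarrow> (nat \<Rightarrow> 'b ugraph) \<Rightarrow> bool" where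
  "linearly_equivalent X Y \<longleftrightarrow>
     (\<exists>f. linear_function f \<and> (\<forall>k. X k \<preceq> Y (f k) \<and> Y k \<preceq> X (f k)))"

section \<open>Basic facts\<close>

lemma simple_path_graph: "simple_graph (path_graph m)"
  by (auto simp: simple_graph_def path_graph_def)

lemma simple_cycle_graph:
  assumes "n \<noteq> 1"
  shows "simple_graph (cycle_graph n)"
proof -
  have "j mod n + 1 \<le> n \<and> j \<noteq> j mod n + 1" if "1 \<le> j" "j \<le> n" for j
    using that assms by (cases "j = n") auto
  then have "{j, j mod n + 1} \<subseteq> {1..n} \<and> card {j, j mod n + 1} = 2" if "1 \<le> j" "j \<le> n" for j
    using that by (simp add: card_2_iff doubleton_eq_iff)
  then show ?thesis
    unfolding simple_graph_def cycle_graph_def by auto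
qed

lemma simple_cartesian_product:
  assumes "simple_graph G" "simple_graph H"
  shows "simple_graph (cartesian_product G H)"
proof -
  have G: "x \<in> verts G \<and> x' \<in> verts G \<and> x \<noteq> x'" if "{x, x'} \<in> edges G" for x x'
    using assms(1) that unfolding simple_graph_def by fastforce
  have H: "x \<in> verts H \<and> x' \<in> verts H \<and> x \<noteq> x'" if "{x, x'} \<in> edges H" for x x'
    using assms(2) that unfolding simple_graph_def by fastforce
  have "finite (verts G \<times> verts H)"
    using assms by (simp add: simple_graph_def)
  then show ?thesis
    by (auto simp: simple_graph_def cartesian_product_def dest: G H)
qed

lemma simple_surface_grid:
  assumes "Ic \<subseteq> {1..p}" "Ih \<subseteq> {1..p}"
  shows "simple_graph (surface_grid k p Ic Ih)"
proof -
  let ?G = "cylindrical_grid k (4 * k * p)"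
  have V: "verts ?G = {1..k} \<times> {1..4 * k * p}"
    by (simp add: cylindrical_grid_def cartesian_product_def path_graph_def cycle_graph_def)
  have "4 * k * p \<noteq> 1"
    by simp
  then have G: "simple_graph ?G"
    unfolding cylindrical_grid_def
    by (intro simple_cartesian_product simple_path_graph simple_cycle_graph)
  have b: "4 * k * (i - 1) + 4 * k \<le> 4 * k * p" if "i \<in> {1..p}" for i
  proof -
    have "4 * k * (i - 1) + 4 * k = 4 * k * i"
      using that by (cases i) auto
    then show ?thesis
      using that by simp
  qed
  have E: "{(1, x), (1, y)} \<subseteq> verts ?G \<and> card {(1 :: nat, x), (1, y)} = 2"
    if "1 \<le> x" "x < y" "y \<le> b + 4 * k" "b + 4 * k \<le> 4 * k * p" "1 \<le> k" for x y b
    using that unfolding V by auto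
  have handle: "e \<subseteq> verts ?G \<and> card e = 2" if i: "i \<in> {1..p}" and e: "e \<in> handle_edges k i" for e i
  proof -
    from e obtain j where j: "1 \<le> j" "j \<le> k"
      "e = {(1, 4 * k * (i - 1) + j), (1, 4 * k * (i - 1) + 3 * k - j + 1)} \<or>
       e = {(1, 4 * k * (i - 1) + k + j), (1, 4 * k * (i - 1) + 4 * k - j + 1)}"
      unfolding handle_edges_def Let_def by blast
    from j(3) show ?thesis
    proof
      assume e: "e = {(1, 4 * k * (i - 1) + j), (1, 4 * k * (i - 1) + 3 * k - j + 1)}"
      show ?thesis
        unfolding e by (rule E[OF _ _ _ b[OF i]]) (use j(1,2) in linarith)+
    next
      assume e: "e = {(1, 4 * k * (i - 1) + k + j), (1, 4 * k * (i - 1) + 4 * k - j + 1)}"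
      show ?thesis
        unfolding e by (rule E[OF _ _ _ b[OF i]]) (use j(1,2) in linarith)+
    qed
  qed
  have crosscap: "e \<subseteq> verts ?G \<and> card e = 2" if i: "i \<in> {1..p}" and e: "e \<in> crosscap_edges k i" for e i
  proof -
    from e obtain j where j: "1 \<le> j" "j \<le> 2 * k"
      and e: "e = {(1, 4 * k * (i - 1) + j), (1, 4 * k * (i - 1) + 2 * k + j)}"
      unfolding crosscap_edges_def Let_def by blast
    show ?thesis
      unfolding e by (rule E[OF _ _ _ b[OF i]]) (use j in linarith)+
  qed
  have "e \<subseteq> verts ?G \<and> card e = 2" if "e \<in> edges (surface_grid k p Ic Ih)" for e
  proof -
    consider "e \<in> edges ?G" | i where "i \<in> Ic" "e \<in> crosscap_edges k i"
      | i where "i \<in> Ih" "e \<in> handle_edges k i"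
      using \<open>e \<in> edges (surface_grid k p Ic Ih)\<close> unfolding surface_grid_def Let_def by auto
    then show ?thesis
    proof cases
      case 1
      then show ?thesis
        using G unfolding simple_graph_def by blast
    next
      case (2 i)
      then show ?thesis
        using assms(1) by (intro crosscap) auto
    next
      case (3 i)
      then show ?thesis
        using assms(2) by (intro handle) auto
    qed
  qed
  then show ?thesis
    using G by (simp add: simple_graph_def surface_grid_def Let_def)
qed

lemma simple_mixed_surface_grid:
  assumes "mixed_surface_grid k c h G"
  shows "simple_graph G"
proof -
  obtain Ic Ih where I: "Ic \<union> Ih = {2..c + h + 1}" "G = surface_grid k (c + h + 1) Ic Ih"
    using assms unfolding mixed_surface_grid_def by blast
  have "{2..c + h + 1} \<subseteq> {1..c + h + 1}"
    by auto
  then show ?thesis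
    unfolding I(2) using I(1) by (intro simple_surface_grid) blast+
qed

lemma mixed_surface_grid_dyck_grid: "mixed_surface_grid k c h (dyck_grid h c k)"
  unfolding mixed_surface_grid_def dyck_grid_def
  by (rule exI[of _ "{h + 2..h + c + 1}"], rule exI[of _ "{2..h + 1}"]) auto

lemma parametric_graph_dyck_grid: "parametric_graph (dyck_grid h c)"
  using mixed_surface_grid_dyck_grid simple_mixed_surface_grid
  unfolding parametric_graph_def by blast

lemma mixed_surface_grid_0:
  "mixed_surface_grid 0 c h G \<Longrightarrow> G = \<lparr>verts = {}, edges = {}\<rparr>"
  by (auto simp: mixed_surface_grid_def surface_grid_def cylindrical_grid_def
      cartesian_product_def path_graph_def cycle_graph_def handle_edges_def crosscap_edges_def)

end

theory Submission
  imports Defs "HOL-Library.Sublist"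
begin

text \<open>A surface grid is a cylinder with a chord diagram attached to its first cycle: a crosscap is a
  twisted ribbon \<open>x x\<close> of parallel chords and a handle is the pattern \<open>x y x\<^sup>-\<^sup>1 y\<^sup>-\<^sup>1\<close> of two untwisted
  ribbons. If two neighbouring chord ends are joined by a path turning around in the first row, the
  two chords become one, at the cost of one row. Cutting ribbons lengthwise into parallel strands and
  joining strands in this way realises handle slides. As in the classification of surfaces,
  \<open>z z x y x\<^sup>-\<^sup>1 y\<^sup>-\<^sup>1\<close> and \<open>z z x x y y\<close> can be slid into each other, so a handle next to a crosscap may
  be exchanged with two crosscaps, in both directions; the rest of the diagram only gets thinner by a
  constant factor. With \<open>c > 0\<close> all handles disappear one after the other, hence both grids of the
  theorem are equivalent to the grid with \<open>g\<close> crosscaps and no handles, at a loss of a factor 17 per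
  handle.\<close>

section \<open>Connected sets and minors\<close>

lemma connected_in_singleton: "x \<in> verts G \<Longrightarrow> connected_in G {x}"
  by (simp add: connected_in_def)

lemma connected_in_Un:
  assumes "connected_in G S" "connected_in G T" "x \<in> S" "y \<in> T" "x = y \<or> {x, y} \<in> edges G"
  shows "connected_in G (S \<union> T)"
proof -
  define R where "R U = {(u, v). u \<in> U \<and> v \<in> U \<and> {u, v} \<in> edges G}" for U
  have conn: "connected_in G U \<longleftrightarrow> U \<noteq> {} \<and> U \<subseteq> verts G \<and> (\<forall>a\<in>U. \<forall>b\<in>U. (a, b) \<in> (R U)\<^sup>*)" for U
    by (simp add: connected_in_def R_def)
  have "(R S)\<^sup>* \<subseteq> (R (S \<union> T))\<^sup>*" "(R T)\<^sup>* \<subseteq> (R (S \<union> T))\<^sup>*"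
    by (intro rtrancl_mono; auto simp: R_def)+
  then have S: "\<And>a b. \<lbrakk>a \<in> S; b \<in> S\<rbrakk> \<Longrightarrow> (a, b) \<in> (R (S \<union> T))\<^sup>*"
    and T: "\<And>a b. \<lbrakk>a \<in> T; b \<in> T\<rbrakk> \<Longrightarrow> (a, b) \<in> (R (S \<union> T))\<^sup>*"
    using assms(1,2) unfolding conn by blast+
  have xy: "(x, y) \<in> (R (S \<union> T))\<^sup>*" "(y, x) \<in> (R (S \<union> T))\<^sup>*"
    using assms(3-5) by (auto simp: R_def insert_commute)
  have "(a, x) \<in> (R (S \<union> T))\<^sup>* \<and> (x, a) \<in> (R (S \<union> T))\<^sup>*" if "a \<in> S \<union> T" for a
    using that S[of a x] S[of x a] T[of a y] T[of y a] xy assms(3,4) by (auto intro: rtrancl_trans)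
  then have "(a, b) \<in> (R (S \<union> T))\<^sup>*" if "a \<in> S \<union> T" "b \<in> S \<union> T" for a b
    using that by (blast intro: rtrancl_trans)
  then show ?thesis
    using assms(1,2) unfolding conn by blast
qed

text \<open>A walk in \<open>S\<close> lifts edge by edge: each \<open>B u\<close> is connected, and
  an edge of \<open>H\<close> gives a crossing between two branch sets. This is the connectedness
  needed when minors are composed.\<close>

lemma connected_in_UN:
  assumes S: "connected_in H S" and B: "\<And>u. u \<in> S \<Longrightarrow> connected_in G (B u)"
    and E: "\<And>u v. \<lbrakk>u \<in> S; v \<in> S; {u, v} \<in> edges H\<rbrakk> \<Longrightarrow> \<exists>x\<in>B u. \<exists>y\<in>B v. {x, y} \<in> edges G"
  shows "connected_in G (\<Union>u\<in>S. B u)"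
proof -
  define R where "R U = {(u, v). u \<in> U \<and> v \<in> U \<and> {u, v} \<in> edges G}" for U
  have conn: "connected_in G U \<longleftrightarrow> U \<noteq> {} \<and> U \<subseteq> verts G \<and> (\<forall>a\<in>U. \<forall>b\<in>U. (a, b) \<in> (R U)\<^sup>*)" for U
    by (simp add: connected_in_def R_def)
  let ?T = "\<Union>u\<in>S. B u"
  have inner: "(a, b) \<in> (R ?T)\<^sup>*" if "u \<in> S" "a \<in> B u" "b \<in> B u" for u a b
  proof -
    have "(a, b) \<in> (R (B u))\<^sup>*"
      using B[OF that(1)] that(2,3) unfolding conn by simp
    moreover have "R (B u) \<subseteq> R ?T"
      using that(1) unfolding R_def by blast
    ultimately show ?thesis
      using rtrancl_mono by blast
  qed
  have outer: "\<forall>a\<in>B u. \<forall>b\<in>B v. (a, b) \<in> (R ?T)\<^sup>*"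
    if "(u, v) \<in> {(u, v). u \<in> S \<and> v \<in> S \<and> {u, v} \<in> edges H}\<^sup>*" "u \<in> S" for u v
    using that
  proof (induction rule: rtrancl_induct)
    case base
    then show ?case
      using inner by simp
  next
    case (step v w)
    then have vw: "v \<in> S" "w \<in> S" "{v, w} \<in> edges H"
      by auto
    obtain x y where xy: "x \<in> B v" "y \<in> B w" "{x, y} \<in> edges G"
      using E[OF vw] by auto
    have "(x, y) \<in> R ?T"
      using xy vw unfolding R_def by auto
    then have "(a, b) \<in> (R ?T)\<^sup>*" if "a \<in> B u" "b \<in> B w" for a b
      using step.IH[OF step.prems] that(1) xy(1) inner[OF vw(2) xy(2) that(2)]
      by (meson rtrancl_into_rtrancl rtrancl_trans)
    then show ?case
      by simp
  qed
  have "(a, b) \<in> (R ?T)\<^sup>*" if ab: "a \<in> ?T" "b \<in> ?T" for a b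
  proof -
    obtain u v where "u \<in> S" "v \<in> S" "a \<in> B u" "b \<in> B v"
      using ab by auto
    moreover from this have "(u, v) \<in> {(u, v). u \<in> S \<and> v \<in> S \<and> {u, v} \<in> edges H}\<^sup>*"
      using S unfolding connected_in_def by simp
    ultimately show ?thesis
      using outer by simp
  qed
  moreover have "?T \<noteq> {}" "?T \<subseteq> verts G"
    using S B unfolding connected_in_def by auto
  ultimately show ?thesis
    unfolding conn by simp
qed

section \<open>The minor relation as a preorder\<close>

lemma minor_refl: "G \<preceq> G"
  unfolding minor_def by (rule exI[of _ "\<lambda>x. {x}"]) (auto intro: connected_in_singleton)

lemma minor_trans:
  assumes "F \<preceq> H" "H \<preceq> G"
  shows "F \<preceq> G"
proof -
  obtain B where B: "\<forall>u\<in>verts F. connected_in H (B u)"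
    "\<forall>u\<in>verts F. \<forall>v\<in>verts F. u \<noteq> v \<longrightarrow> B u \<inter> B v = {}"
    "\<forall>u v. {u, v} \<in> edges F \<longrightarrow> (\<exists>x\<in>B u. \<exists>y\<in>B v. {x, y} \<in> edges H)"
    using assms(1) unfolding minor_def by blast
  obtain C where C: "\<forall>u\<in>verts H. connected_in G (C u)"
    "\<forall>u\<in>verts H. \<forall>v\<in>verts H. u \<noteq> v \<longrightarrow> C u \<inter> C v = {}"
    "\<forall>u v. {u, v} \<in> edges H \<longrightarrow> (\<exists>x\<in>C u. \<exists>y\<in>C v. {x, y} \<in> edges G)"
    using assms(2) unfolding minor_def by blast
  have sub: "B u \<subseteq> verts H" if "u \<in> verts F" for u
    using B(1) that unfolding connected_in_def by blast
  show ?thesis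
    unfolding minor_def
  proof (intro exI[of _ "\<lambda>u. \<Union>x\<in>B u. C x"] conjI ballI allI impI)
    fix u assume u: "u \<in> verts F"
    show "connected_in G (\<Union>x\<in>B u. C x)"
      using B(1) C(1,3) u sub[OF u] by (intro connected_in_UN[of H]) auto
  next
    fix u v assume uv: "u \<in> verts F" "v \<in> verts F" "u \<noteq> v"
    have disj: "C x \<inter> C y = {}" if "x \<in> B u" "y \<in> B v" for x y
    proof -
      have "x \<in> verts H" "y \<in> verts H" "x \<noteq> y"
        using that sub uv B(2) by (auto simp: disjoint_iff)
      then show ?thesis
        using C(2) by simp
    qed
    show "(\<Union>x\<in>B u. C x) \<inter> (\<Union>x\<in>B v. C x) = {}"
    proof (rule equals0I)
      fix z assume "z \<in> (\<Union>x\<in>B u. C x) \<inter> (\<Union>x\<in>B v. C x)"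
      then obtain x y where "x \<in> B u" "y \<in> B v" "z \<in> C x \<inter> C y"
        by (elim IntE UN_E) simp
      then show False
        using disj[of x y] by simp
    qed
  next
    fix u v assume "{u, v} \<in> edges F"
    then obtain a b where ab: "a \<in> B u" "b \<in> B v" "{a, b} \<in> edges H"
      using B(3) by meson
    then obtain x y where "x \<in> C a" "y \<in> C b" "{x, y} \<in> edges G"
      using C(3) by meson
    then show "\<exists>x\<in>\<Union>x\<in>B u. C x. \<exists>y\<in>\<Union>x\<in>B v. C x. {x, y} \<in> edges G"
      using ab(1,2) by (intro bexI[of _ x] bexI[of _ y]) auto
  qed
qed

section \<open>Cylindrical grids with chords\<close>

text \<open>The chords lie on the first cycle only, so the other rows keep the cylinder intact while
  the first one is used for rerouting.\<close>

definition chord_grid :: "nat \<Rightarrow> nat \<Rightarrow> (nat \<Rightarrow> nat \<Rightarrow> bool) \<Rightarrow> (nat \<times> nat) ugraph" where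
  "chord_grid d n E = (let G = cylindrical_grid d n in
     \<lparr>verts = verts G, edges = edges G \<union> {{(1, x), (1, y)} | x y. E x y}\<rparr>)"

lemma verts_chord_grid: "verts (chord_grid d n E) = {1..d} \<times> {1..n}"
  by (simp add: chord_grid_def cylindrical_grid_def cartesian_product_def path_graph_def
      cycle_graph_def)

lemma edges_chord_grid:
  "edges (chord_grid d n E) =
     {{(i, x), (i, x mod n + 1)} | i x. i \<in> {1..d} \<and> x \<in> {1..n}} \<union>
     {{(i, x), (i + 1, x)} | i x. 1 \<le> i \<and> i < d \<and> x \<in> {1..n}} \<union>
     {{(1, x), (1, y)} | x y. E x y}"
proof -
  have 1: "{{(i, x), (i, y)} | i x y. i \<in> {1..d} \<and> {x, y} \<in> edges (cycle_graph n)} =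
    {{(i, x), (i, x mod n + 1)} | i x. i \<in> {1..d} \<and> x \<in> {1..n}}" (is "?L = ?R")
  proof
    show "?L \<subseteq> ?R"
    proof clarify
      fix i x y assume "i \<in> {1..d}" "{x, y} \<in> edges (cycle_graph n)"
      then obtain j where "{x, y} = {j, j mod n + 1}" "j \<in> {1..n}"
        by (auto simp: cycle_graph_def)
      then have "{(i, x), (i, y)} = {(i, j), (i, j mod n + 1)}"
        by (auto simp: doubleton_eq_iff)
      then show "\<exists>i' x'. {(i, x), (i, y)} = {(i', x'), (i', x' mod n + 1)} \<and>
          i' \<in> {1..d} \<and> x' \<in> {1..n}"
        using \<open>i \<in> {1..d}\<close> \<open>j \<in> {1..n}\<close> by blast
    qed
    show "?R \<subseteq> ?L"
      by (fastforce simp: cycle_graph_def)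
  qed
  have 2: "{{(i, x), (j, x)} | i j x. {i, j} \<in> edges (path_graph d) \<and> x \<in> {1..n}} =
    {{(i, x), (i + 1, x)} | i x. 1 \<le> i \<and> i < d \<and> x \<in> {1..n}}" (is "?L = ?R")
  proof
    show "?L \<subseteq> ?R"
    proof clarify
      fix i j x assume "x \<in> {1..n}" "{i, j} \<in> edges (path_graph d)"
      then obtain l where "{i, j} = {l, l + 1}" "1 \<le> l" "l < d"
        by (auto simp: path_graph_def)
      then have "{(i, x), (j, x)} = {(l, x), (l + 1, x)}"
        by (auto simp: doubleton_eq_iff)
      then show "\<exists>i' x'. {(i, x), (j, x)} = {(i', x'), (i' + 1, x')} \<and>
          1 \<le> i' \<and> i' < d \<and> x' \<in> {1..n}"
        using \<open>1 \<le> l\<close> \<open>l < d\<close> \<open>x \<in> {1..n}\<close> by blast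
    qed
    show "?R \<subseteq> ?L"
      by (fastforce simp: path_graph_def)
  qed
  show ?thesis
    unfolding 1[symmetric] 2[symmetric]
    by (simp add: chord_grid_def cylindrical_grid_def cartesian_product_def path_graph_def
        cycle_graph_def)
qed

lemma chord_grid_edgeI:
  shows "\<lbrakk>1 \<le> i; i \<le> d; 1 \<le> x; x < n\<rbrakk> \<Longrightarrow> {(i, x), (i, Suc x)} \<in> edges (chord_grid d n E)"
    and "\<lbrakk>1 \<le> i; i \<le> d; 1 \<le> n\<rbrakk> \<Longrightarrow> {(i, n), (i, 1)} \<in> edges (chord_grid d n E)"
    and "\<lbrakk>1 \<le> i; i < d; 1 \<le> x; x \<le> n\<rbrakk> \<Longrightarrow> {(i, x), (Suc i, x)} \<in> edges (chord_grid d n E)"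
    and "E x y \<Longrightarrow> {(1, x), (1, y)} \<in> edges (chord_grid d n E)"
proof -
  assume "1 \<le> i" "i \<le> d" "1 \<le> x" "x < n"
  then have "{(i, x), (i, Suc x)} = {(i, x), (i, x mod n + 1)} \<and> i \<in> {1..d} \<and> x \<in> {1..n}"
    by simp
  then show "{(i, x), (i, Suc x)} \<in> edges (chord_grid d n E)"
    unfolding edges_chord_grid by blast
next
  assume "1 \<le> i" "i \<le> d" "1 \<le> n"
  then have "{(i, n), (i, 1)} = {(i, n), (i, n mod n + 1)} \<and> i \<in> {1..d} \<and> n \<in> {1..n}"
    by simp
  then show "{(i, n), (i, 1)} \<in> edges (chord_grid d n E)"
    unfolding edges_chord_grid by blast
next
  assume "1 \<le> i" "i < d" "1 \<le> x" "x \<le> n"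
  then have "{(i, x), (Suc i, x)} = {(i, x), (i + 1, x)} \<and> 1 \<le> i \<and> i < d \<and> x \<in> {1..n}"
    by simp
  then show "{(i, x), (Suc i, x)} \<in> edges (chord_grid d n E)"
    unfolding edges_chord_grid by blast
next
  assume "E x y"
  then show "{(1, x), (1, y)} \<in> edges (chord_grid d n E)"
    unfolding edges_chord_grid by blast
qed

text \<open>By symmetry it suffices to join the branch sets in one orientation for each kind of
  edge, and to check disjointness for \<open>i \<le> j\<close>.\<close>

lemma minor_chord_gridI:
  assumes "\<And>i x. \<lbrakk>1 \<le> i; i \<le> d; 1 \<le> x; x \<le> n\<rbrakk> \<Longrightarrow> connected_in G (B (i, x))"
    and "\<And>i x j y. \<lbrakk>(i, x) \<noteq> (j, y); i \<le> j; 1 \<le> i; j \<le> d; 1 \<le> x; x \<le> n; 1 \<le> y; y \<le> n\<rbrakk>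
      \<Longrightarrow> B (i, x) \<inter> B (j, y) = {}"
    and row: "\<And>i x. \<lbrakk>1 \<le> i; i \<le> d; 1 \<le> x; x < n\<rbrakk>
      \<Longrightarrow> \<exists>u\<in>B (i, x). \<exists>v\<in>B (i, Suc x). {u, v} \<in> edges G"
    and wrap: "\<And>i. \<lbrakk>1 \<le> i; i \<le> d; 1 \<le> n\<rbrakk> \<Longrightarrow> \<exists>u\<in>B (i, n). \<exists>v\<in>B (i, 1). {u, v} \<in> edges G"
    and col: "\<And>i x. \<lbrakk>1 \<le> i; i < d; 1 \<le> x; x \<le> n\<rbrakk>
      \<Longrightarrow> \<exists>u\<in>B (i, x). \<exists>v\<in>B (Suc i, x). {u, v} \<in> edges G"
    and chord: "\<And>x y. E x y \<Longrightarrow> \<exists>u\<in>B (1, x). \<exists>v\<in>B (1, y). {u, v} \<in> edges G"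
  shows "chord_grid d n E \<preceq> G"
proof -
  let ?J = "\<lambda>a b. \<exists>u\<in>B a. \<exists>v\<in>B b. {u, v} \<in> edges G"
  have sym: "?J b a" if "?J a b" for a b
    using that by (metis insert_commute)
  have J: "?J (i, x) (i, x mod n + 1)" if "i \<in> {1..d}" "x \<in> {1..n}" for i x
    using that row[of i x] wrap[of i] by (cases "x = n") auto
  have edge: "?J a b" if ab: "{a, b} \<in> edges (chord_grid d n E)" for a b
  proof -
    consider (row) i x where "{a, b} = {(i, x), (i, x mod n + 1)}" "i \<in> {1..d}" "x \<in> {1..n}"
      | (col) i x where "{a, b} = {(i, x), (i + 1, x)}" "1 \<le> i" "i < d" "x \<in> {1..n}"
      | (chord) x y where "{a, b} = {(1, x), (1, y)}" "E x y"
      using ab unfolding edges_chord_grid by blast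
    then obtain p q where pq: "{a, b} = {p, q}" "?J p q"
    proof cases
      case row
      then show ?thesis using J that by blast
    next
      case (col i x)
      have "?J (i, x) (i + 1, x)"
        using assms(5)[of i x] col by simp
      then show ?thesis using col(1) that by blast
    next
      case (chord x y)
      then show ?thesis using assms(6) that by blast
    qed
    then consider "a = p" "b = q" | "a = q" "b = p"
      by (auto simp: doubleton_eq_iff)
    then show ?thesis
      using pq(2) sym[of p q] by cases simp_all
  qed
  moreover have "B a \<inter> B b = {}"
    if "a \<in> verts (chord_grid d n E)" "b \<in> verts (chord_grid d n E)" "a \<noteq> b" for a b
  proof (cases a, cases b)
    fix i x j y assume "a = (i, x)" "b = (j, y)"
    then show ?thesis
      using that assms(2)[of i x j y] assms(2)[of j y i x]
      by (cases "i \<le> j") (simp_all add: verts_chord_grid Int_commute)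
  qed
  moreover have "connected_in G (B a)" if "a \<in> verts (chord_grid d n E)" for a
    using that assms(1) by (cases a) (simp add: verts_chord_grid)
  ultimately show ?thesis
    unfolding minor_def by blast
qed

section \<open>Selecting columns of a chord grid\<close>

lemma adjacentI:
  "\<lbrakk>u \<in> S; v \<in> T; {u, v} \<in> F\<rbrakk> \<Longrightarrow> \<exists>x\<in>S. \<exists>y\<in>T. {x, y} \<in> F"
  by (rule bexI, rule bexI)

lemma connected_in_row:
  assumes "1 \<le> i" "i \<le> d" "1 \<le> x" "x \<le> y" "y \<le> n"
  shows "connected_in (chord_grid d n E) ({i} \<times> {x..y})"
  using \<open>x \<le> y\<close> \<open>y \<le> n\<close>
proof (induction y rule: dec_induct)
  case base
  then show ?case
    using assms by (auto simp: verts_chord_grid intro: connected_in_singleton)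
next
  case (step y)
  have "{i} \<times> {x..Suc y} = {i} \<times> {x..y} \<union> {(i, Suc y)}"
    using step by auto
  moreover have "connected_in (chord_grid d n E) ({i} \<times> {x..y} \<union> {(i, Suc y)})"
    using step assms
    by (intro connected_in_Un[of _ _ _ "(i, y)" "(i, Suc y)"] connected_in_singleton disjI2
        chord_grid_edgeI) (auto simp: verts_chord_grid)
  ultimately show ?case
    by simp
qed

lemma chord_grid_select_columns:
  assumes n': "1 \<le> n'" and rng: "\<And>z. \<lbrakk>1 \<le> z; z \<le> n'\<rbrakk> \<Longrightarrow> 1 \<le> f z \<and> f z \<le> n"
    and mono: "\<And>z z'. \<lbrakk>1 \<le> z; z < z'; z' \<le> n'\<rbrakk> \<Longrightarrow> f z < f z'"
    and E: "\<And>x y. E' x y \<Longrightarrow> x \<in> {1..n'} \<and> y \<in> {1..n'} \<and> E (f x) (f y)"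
  shows "chord_grid d n' E' \<preceq> chord_grid d n E"
proof -
  \<comment> \<open>The last block also takes the columns before \<open>f 1\<close>, so that the
    blocks cover the whole cycle and its closing edge survives.\<close>
  define I where "I z = (if z < n' then {f z..<f (Suc z)} else {f z..n} \<union> {1..<f 1})" for z
  have fI: "f z \<in> I z" if "1 \<le> z" "z \<le> n'" for z
    using that mono[of z "Suc z"] rng[of z] by (auto simp: I_def)
  have le: "f z \<le> f z'" if "1 \<le> z" "z \<le> z'" "z' \<le> n'" for z z'
    using mono[of z z'] that by (cases "z = z'") auto
  have disj: "I z \<inter> I z' = {}" if "1 \<le> z" "z < z'" "z' \<le> n'" for z z'
    using that le[of "Suc z" z'] le[of 1 z] mono[of z z'] unfolding I_def by auto
  have conn: "connected_in (chord_grid d n E) ({i} \<times> I z)" if "1 \<le> i" "i \<le> d" "1 \<le> z" "z \<le> n'" for i z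
  proof (cases "z < n'")
    case True
    then have "I z = {f z..f (Suc z) - 1}"
      using that mono[of z "Suc z"] by (auto simp: I_def)
    then show ?thesis
      using that True mono[of z "Suc z"] rng[of z] rng[of "Suc z"]
      by (auto intro!: connected_in_row)
  next
    case False
    have R: "connected_in (chord_grid d n E) ({i} \<times> {f z..n})"
      using that rng[of z] by (intro connected_in_row) auto
    show ?thesis
    \<comment> \<open>For \<open>f 1 = 1\<close> the wrapped part of the last block is empty, which
      \<open>connected_in\<close> excludes.\<close>
    proof (cases "f 1 = 1")
      case True
      then show ?thesis
        using R False by (simp add: I_def)
    next
      case ne: False
      have L: "connected_in (chord_grid d n E) ({i} \<times> {1..f 1 - 1})"
        using that n' rng[of 1] ne by (intro connected_in_row) auto
      have "connected_in (chord_grid d n E) (({i} \<times> {f z..n}) \<union> ({i} \<times> {1..f 1 - 1}))"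
        using that rng[of z] rng[of 1] ne n'
        by (intro connected_in_Un[OF R L, of "(i, n)" "(i, 1)"] disjI2 chord_grid_edgeI) auto
      moreover have "({i} \<times> {f z..n}) \<union> ({i} \<times> {1..f 1 - 1}) = {i} \<times> I z"
        using False ne by (auto simp: I_def)
      ultimately show ?thesis
        by simp
    qed
  qed
  show ?thesis
  proof (rule minor_chord_gridI[of _ _ _ "\<lambda>(i, z). {i} \<times> I z"]; unfold prod.case)
    show "connected_in (chord_grid d n E) ({i} \<times> I z)" if "1 \<le> i" "i \<le> d" "1 \<le> z" "z \<le> n'" for i z
      using conn that .
  next
    fix i j x y assume "(i, x) \<noteq> (j, y)" "i \<le> j" "1 \<le> x" "x \<le> n'" "1 \<le> y" "y \<le> n'"
    then show "{i} \<times> I x \<inter> {j} \<times> I y = {}"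
      using disj[of x y] disj[of y x] by (cases x y rule: linorder_cases) auto
  next
    fix i x assume x: "1 \<le> i" "i \<le> d" "1 \<le> x" "x < n'"
    obtain a where a: "f (Suc x) = Suc a"
      using rng[of "Suc x"] x by (cases "f (Suc x)") auto
    have "f x \<le> a" "1 \<le> f x" "Suc a \<le> n"
      using mono[of x "Suc x"] rng[of x] rng[of "Suc x"] x a by auto
    moreover from this have "a \<in> I x"
      using x a by (simp add: I_def)
    ultimately show "\<exists>u\<in>{i} \<times> I x. \<exists>v\<in>{i} \<times> I (Suc x). {u, v} \<in> edges (chord_grid d n E)"
      using x a fI[of "Suc x"] by (intro adjacentI[of "(i, a)" _ "(i, Suc a)"] chord_grid_edgeI) auto
  next
    fix i assume i: "1 \<le> i" "i \<le> d"
    have r: "1 \<le> f 1" "f 1 \<le> n" "1 \<le> f n'" "f n' \<le> n"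
      using rng n' by auto
    show "\<exists>u\<in>{i} \<times> I n'. \<exists>v\<in>{i} \<times> I 1. {u, v} \<in> edges (chord_grid d n E)"
    proof (cases "f 1 = 1")
      case True
      then show ?thesis
        using i r fI[of 1] n' by (intro adjacentI[of "(i, n)" _ "(i, 1)"] chord_grid_edgeI) (auto simp: I_def)
    next
      case False
      then obtain a where "f 1 = Suc a" "1 \<le> a"
        using r by (cases "f 1") auto
      then show ?thesis
        using i r fI[of 1] n' by (intro adjacentI[of "(i, a)" _ "(i, Suc a)"] chord_grid_edgeI) (auto simp: I_def)
    qed
  next
    fix i x assume "1 \<le> i" "i < d" "1 \<le> x" "x \<le> n'"
    then show "\<exists>u\<in>{i} \<times> I x. \<exists>v\<in>{Suc i} \<times> I x. {u, v} \<in> edges (chord_grid d n E)"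
      using rng[of x] fI[of x] by (intro adjacentI[of "(i, f x)" _ "(Suc i, f x)"] chord_grid_edgeI) auto
  next
    fix x y assume "E' x y"
    then show "\<exists>u\<in>{1} \<times> I x. \<exists>v\<in>{1} \<times> I y. {u, v} \<in> edges (chord_grid d n E)"
      using E[of x y] fI[of x] fI[of y]
      by (intro adjacentI[of "(1, f x)" _ "(1, f y)"] chord_grid_edgeI) auto
  qed
qed

text \<open>A path that enters the first row through a chord at column \<open>p\<close> turns around there and
  leaves through a chord at column \<open>p + 1\<close>, which uses up one row.\<close>

lemma chord_grid_uturn:
  assumes E: "\<And>x y. E x y \<Longrightarrow> x \<in> {1..n} \<and> y \<in> {1..n}"
    and sym: "\<And>x y. E x y \<Longrightarrow> E y x"
    and uniq: "\<And>x y. \<lbrakk>E x p; E y p; x \<noteq> Suc p; y \<noteq> Suc p\<rbrakk> \<Longrightarrow> x = y"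
    and E': "\<And>x y. E' x y \<Longrightarrow> {x, y} \<inter> {p, Suc p} = {} \<and>
      (E x y \<or> (E x p \<and> E (Suc p) y) \<or> (E y p \<and> E (Suc p) x))"
  shows "chord_grid d n E' \<preceq> chord_grid (Suc d) n E"
proof -
  let ?G = "chord_grid (Suc d) n E"
  \<comment> \<open>Row \<open>i\<close> becomes row \<open>Suc i\<close>, which frees the first
    row. There a column \<open>z\<close> keeps its own chord end, and the only column outside the
    turn with a chord to \<open>p\<close> also takes the two turning vertices.\<close>
  define ext where "ext z = (if z \<in> {p, Suc p} then {} else
    insert (1::nat, z) (if E z p \<and> Suc p \<le> n then {1} \<times> {p..Suc p} else {}))" for z
  define B where "B = (\<lambda>(i, z). insert (Suc i, z) (if i = 1 then ext z else {}))"
  have BI: "(Suc i, z) \<in> B (i, z)" for i z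
    by (simp add: B_def)
  have ext_row: "fst a = 1" if "a \<in> ext z" for a z
    using that by (auto simp: ext_def split: if_splits)
  have disj: "ext x \<inter> ext y = {}" if "x \<noteq> y" for x y
    using that uniq[of x y] by (auto simp: ext_def split: if_splits)
  have one: "(1, z) \<in> B (1, z)" if "z \<notin> {p, Suc p}" for z
    using that by (auto simp: B_def ext_def)
  have two: "(1, Suc p) \<in> B (1, z)" if "z \<notin> {p, Suc p}" "E z p" "Suc p \<le> n" for z
    using that by (auto simp: B_def ext_def)
  show ?thesis
  proof (rule minor_chord_gridI[of _ _ _ B])
    fix i x assume x: "1 \<le> i" "i \<le> d" "1 \<le> x" "x \<le> n"
    have s: "connected_in ?G {(Suc i, x)}"
      using x by (intro connected_in_singleton) (auto simp: verts_chord_grid)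
    show "connected_in ?G (B (i, x))"
    proof (cases "i = 1 \<and> x \<notin> {p, Suc p}")
      case False
      then show ?thesis
        using s by (auto simp: B_def ext_def)
    next
      case True
      have c1: "connected_in ?G {(1, x)}"
        using x by (intro connected_in_singleton) (auto simp: verts_chord_grid)
      have c2: "connected_in ?G ({(Suc 1, x)} \<union> {(1, x)})"
        using x s c1 True chord_grid_edgeI(3)[of 1 "Suc d" x n E]
        by (intro connected_in_Un[of _ _ _ "(Suc 1, x)" "(1, x)"]) (auto simp: insert_commute)
      show ?thesis
      proof (cases "E x p \<and> Suc p \<le> n")
        case False
        then show ?thesis
          using c2 True by (auto simp: B_def ext_def insert_commute)
      next
        case Ep: True
        then have "1 \<le> p"
          using E by auto
        then have c3: "connected_in ?G ({1} \<times> {p..Suc p})"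
          using Ep by (intro connected_in_row) auto
        have "connected_in ?G (({(Suc 1, x)} \<union> {(1, x)}) \<union> {1} \<times> {p..Suc p})"
          using Ep by (intro connected_in_Un[OF c2 c3, of "(1, x)" "(1, p)"] disjI2
              chord_grid_edgeI) auto
        then show ?thesis
          using True Ep by (simp add: B_def ext_def insert_commute)
      qed
    qed
  next
    fix i j x y :: nat assume ij: "(i, x) \<noteq> (j, y)" "i \<le> j" "1 \<le> i"
    have no: "(Suc l, z') \<notin> ext z" if "1 \<le> l" for l z z'
      using ext_row[of "(Suc l, z')" z] that by auto
    show "B (i, x) \<inter> B (j, y) = {}"
    proof (cases "j = 1")
      case True
      then have "i = 1" "x \<noteq> y"
        using ij by auto
      then show ?thesis
        using True disj[of x y] no[of 1] by (simp add: B_def)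
    next
      case False
      then show ?thesis
        using ij no[of j] by (auto simp: B_def)
    qed
  next
    fix i x assume "1 \<le> i" "i \<le> d" "1 \<le> x" "x < n"
    then show "\<exists>u\<in>B (i, x). \<exists>v\<in>B (i, Suc x). {u, v} \<in> edges ?G"
      using BI by (intro adjacentI[of "(Suc i, x)" _ "(Suc i, Suc x)"] chord_grid_edgeI) auto
  next
    fix i assume "1 \<le> i" "i \<le> d" "1 \<le> n"
    then show "\<exists>u\<in>B (i, n). \<exists>v\<in>B (i, 1). {u, v} \<in> edges ?G"
      using BI by (intro adjacentI[of "(Suc i, n)" _ "(Suc i, 1)"] chord_grid_edgeI) auto
  next
    fix i x assume "1 \<le> i" "i < d" "1 \<le> x" "x \<le> n"
    then show "\<exists>u\<in>B (i, x). \<exists>v\<in>B (Suc i, x). {u, v} \<in> edges ?G"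
      using BI by (intro adjacentI[of "(Suc i, x)" _ "(Suc (Suc i), x)"] chord_grid_edgeI) auto
  next
    fix x y assume "E' x y"
    then have ne: "x \<notin> {p, Suc p}" "y \<notin> {p, Suc p}" and
      "E x y \<or> (E x p \<and> E (Suc p) y) \<or> (E y p \<and> E (Suc p) x)"
      using E'[of x y] by simp_all
    then consider "E x y" | "E x p" "E (Suc p) y" | "E y p" "E (Suc p) x"
      by argo
    then show "\<exists>u\<in>B (1, x). \<exists>v\<in>B (1, y). {u, v} \<in> edges ?G"
    proof cases
      case 1
      then show ?thesis
        using ne by (intro adjacentI[of "(1, x)" _ "(1, y)"] one chord_grid_edgeI)
    next
      case 2
      then show ?thesis
        using ne E by (intro adjacentI[of "(1, Suc p)" _ "(1, y)"] one two chord_grid_edgeI) auto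
    next
      case 3
      then show ?thesis
        using ne E sym by (intro adjacentI[of "(1, x)" _ "(1, Suc p)"] one two chord_grid_edgeI) auto
    qed
  qed
qed

section \<open>Chord diagrams as words\<close>

text \<open>Columns count from 1, as on the cycles, while list positions count from 0. A letter that
  occurs once leaves its column without a chord.\<close>

definition linked :: "'a list \<Rightarrow> nat \<Rightarrow> nat \<Rightarrow> bool" where
  "linked w x y \<longleftrightarrow> x \<in> {1..length w} \<and> y \<in> {1..length w} \<and> x \<noteq> y \<and> w ! (x - 1) = w ! (y - 1)"

definition word_grid :: "nat \<Rightarrow> 'a list \<Rightarrow> (nat \<times> nat) ugraph" where
  "word_grid d w = chord_grid d (length w) (linked w)"

lemma subseq_indices:
  assumes "subseq u v"
  obtains f where "\<And>i. i < length u \<Longrightarrow> f i < length v \<and> u ! i = v ! f i"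
    and "\<And>i j. \<lbrakk>i < j; j < length u\<rbrakk> \<Longrightarrow> f i < f j"
  using assms
proof (induction u v arbitrary: thesis)
  case (list_emb_Nil v)
  then show ?case by simp
next
  case (list_emb_Cons u v y)
  obtain f where f: "\<And>i. i < length u \<Longrightarrow> f i < length v \<and> u ! i = v ! f i"
    "\<And>i j. \<lbrakk>i < j; j < length u\<rbrakk> \<Longrightarrow> f i < f j"
    using list_emb_Cons.IH by blast
  show ?case
    by (rule list_emb_Cons.prems[of "\<lambda>i. Suc (f i)"]) (use f in auto)
next
  case (list_emb_Cons2 x y u v)
  obtain f where f: "\<And>i. i < length u \<Longrightarrow> f i < length v \<and> u ! i = v ! f i"
    "\<And>i j. \<lbrakk>i < j; j < length u\<rbrakk> \<Longrightarrow> f i < f j"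
    using list_emb_Cons2.IH by blast
  show ?case
    by (rule list_emb_Cons2.prems[of "\<lambda>i. case i of 0 \<Rightarrow> 0 | Suc i \<Rightarrow> Suc (f i)"])
      (use f list_emb_Cons2.hyps in \<open>auto split: nat.split\<close>)
qed

text \<open>The embedding selects the columns. The renaming \<open>s\<close> is arbitrary, since
  identifying letters only adds chords to the larger grid.\<close>

lemma word_grid_subseq:
  assumes "subseq (map s u) v" "u \<noteq> []"
  shows "word_grid d u \<preceq> word_grid d v"
proof -
  obtain f where f: "\<And>i. i < length u \<Longrightarrow> f i < length v \<and> map s u ! i = v ! f i"
    "\<And>i j. \<lbrakk>i < j; j < length u\<rbrakk> \<Longrightarrow> f i < f j"
    by (rule subseq_indices[OF assms(1)]) auto
  have lt: "x - 1 < length u" if "x \<in> {1..length u}" for x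
    using that by auto
  show ?thesis
    unfolding word_grid_def
  proof (rule chord_grid_select_columns[where f = "\<lambda>z. Suc (f (z - 1))"])
    show "1 \<le> length u"
      using assms(2) by (cases u) auto
  next
    fix x y assume xy: "linked u x y"
    then have "x - 1 < length u" "y - 1 < length u" "x - 1 < y - 1 \<or> y - 1 < x - 1"
      by (auto simp: linked_def)
    then have "f (x - 1) \<noteq> f (y - 1)" "v ! f (x - 1) = v ! f (y - 1)"
      using f(2)[of "x - 1" "y - 1"] f(2)[of "y - 1" "x - 1"] f(1)[of "x - 1"] f(1)[of "y - 1"] xy
      by (auto simp: linked_def)
    then show "x \<in> {1..length u} \<and> y \<in> {1..length u} \<and>
        linked v (Suc (f (x - 1))) (Suc (f (y - 1)))"
      using xy f(1)[OF lt] by (auto simp: linked_def Suc_le_eq)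
  next
    fix z assume "1 \<le> z" "z \<le> length u"
    then show "1 \<le> Suc (f (z - 1)) \<and> Suc (f (z - 1)) \<le> length v"
      using f(1)[of "z - 1"] by (auto simp: Suc_le_eq)
  next
    fix z z' assume "1 \<le> z" "z < z'" "z' \<le> length u"
    then show "Suc (f (z - 1)) < Suc (f (z' - 1))"
      using f(2)[of "z - 1" "z' - 1"] by auto
  qed
qed

text \<open>The U-turn beyond the last column reroutes no chord.\<close>

lemma word_grid_Suc: "word_grid d w \<preceq> word_grid (Suc d) w"
  unfolding word_grid_def
  by (rule chord_grid_uturn[where p = "Suc (length w)"]) (auto simp: linked_def)

lemma word_grid_mono_depth: "d \<le> d' \<Longrightarrow> word_grid d w \<preceq> word_grid d' w"
proof (induction d' rule: dec_induct)
  case base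
  show ?case
    by (rule minor_refl)
next
  case (step d')
  then show ?case
    using minor_trans word_grid_Suc by blast
qed

text \<open>The turn between the two neighbouring columns joins the chords of \<open>x\<close> and
  \<open>y\<close>, so the remaining \<open>y\<close> is renamed to \<open>x\<close>. With at most
  two occurrences of \<open>x\<close>, at most one chord from outside the turn enters at the column
  of \<open>x\<close>.\<close>

lemma word_grid_uturn:
  assumes "x \<noteq> y" "count_list (P @ [x, y] @ Q) x \<le> 2" "P @ Q \<noteq> []"
  shows "word_grid d (map (\<lambda>z. if z = y then x else z) (P @ Q)) \<preceq> word_grid (Suc d) (P @ [x, y] @ Q)"
proof -
  let ?w = "P @ [x, y] @ Q" and ?p = "Suc (length P)"
  let ?g = "\<lambda>z. if z = y then x else z"
  \<comment> \<open>The chords of the shortened word, still on the columns of the long one. They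
    avoid the two turning columns, which the map \<open>f\<close> below then skips.\<close>
  define E' where "E' a b \<longleftrightarrow> {a, b} \<subseteq> {1..length ?w} - {?p, Suc ?p} \<and> a \<noteq> b \<and>
    ?g (?w ! (a - 1)) = ?g (?w ! (b - 1))" for a b
  have wx: "?w ! (?p - 1) = x" and wy: "?w ! (Suc ?p - 1) = y"
    by (simp_all add: nth_append)
  have "chord_grid d (length (map ?g (P @ Q))) (linked (map ?g (P @ Q))) \<preceq> chord_grid d (length ?w) E'"
  proof (rule chord_grid_select_columns[where f = "\<lambda>z. if z < ?p then z else z + 2"])
    show "1 \<le> length (map ?g (P @ Q))"
      using assms(3) by (cases "P @ Q") auto
  next
    fix a b assume ab: "linked (map ?g (P @ Q)) a b"
    have nth: "map ?g (P @ Q) ! (z - 1) = ?g (?w ! ((if z < ?p then z else z + 2) - 1))"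
      if "z \<in> {1..length (P @ Q)}" for z
    proof (cases "z < ?p")
      case True
      then have "z - 1 < length P"
        using that by auto
      then show ?thesis
        using True by (simp add: nth_append)
    next
      case False
      then have "z - 1 = length P + (z - ?p)"
        by simp
      moreover have "z + 2 - 1 = length P + (Suc (Suc (z - ?p)))"
        using False by simp
      moreover have "z - ?p < length Q"
        using that False by auto
      ultimately show ?thesis
        using False by (simp only: nth_append_length_plus nth_append if_False map_append
            length_map not_add_less1 diff_add_inverse nth_map) simp
    qed
    show "a \<in> {1..length (map ?g (P @ Q))} \<and> b \<in> {1..length (map ?g (P @ Q))} \<and>
        E' (if a < ?p then a else a + 2) (if b < ?p then b else b + 2)"
      using ab nth[of a] nth[of b] unfolding E'_def linked_def by (auto simp del: map_append)
  qed auto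
  moreover have "chord_grid d (length ?w) E' \<preceq> chord_grid (Suc d) (length ?w) (linked ?w)"
  proof (rule chord_grid_uturn)
    fix a b assume ab: "linked ?w a ?p" "linked ?w b ?p" "a \<noteq> Suc ?p" "b \<noteq> Suc ?p"
    show "a = b"
    proof (rule ccontr)
      assume "a \<noteq> b"
      let ?S = "{?p - 1, a - 1, b - 1}"
      have "?S \<subseteq> {i. i < length ?w \<and> ?w ! i = x}"
        using ab wx unfolding linked_def by auto
      then have "card ?S \<le> count_list ?w x"
        unfolding count_list_eq_length_filter length_filter_conv_card
        by (intro card_mono) (auto simp: eq_commute)
      moreover have "a - 1 \<noteq> b - 1" "a - 1 \<noteq> ?p - 1" "b - 1 \<noteq> ?p - 1"
        using ab \<open>a \<noteq> b\<close> unfolding linked_def by auto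
      then have "card ?S = 3"
        by auto
      ultimately show False
        using assms(2) by simp
    qed
  next
    fix a b assume "E' a b"
    then have ab: "a \<in> {1..length ?w}" "b \<in> {1..length ?w}" "a \<notin> {?p, Suc ?p}" "b \<notin> {?p, Suc ?p}"
      "a \<noteq> b" "?g (?w ! (a - 1)) = ?g (?w ! (b - 1))"
      unfolding E'_def by auto
    then consider "?w ! (a - 1) = ?w ! (b - 1)" | "?w ! (a - 1) = x" "?w ! (b - 1) = y"
      | "?w ! (b - 1) = x" "?w ! (a - 1) = y"
      by (auto split: if_splits)
    then have "linked ?w a b \<or> linked ?w a ?p \<and> linked ?w (Suc ?p) b \<or>
        linked ?w b ?p \<and> linked ?w (Suc ?p) a"
      using ab wx wy unfolding linked_def by cases auto
    then show "{a, b} \<inter> {?p, Suc ?p} = {} \<and> (linked ?w a b \<or> linked ?w a ?p \<and> linked ?w (Suc ?p) b \<or>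
        linked ?w b ?p \<and> linked ?w (Suc ?p) a)"
      using ab by blast
  qed (auto simp: linked_def)
  ultimately show ?thesis
    unfolding word_grid_def by (rule minor_trans)
qed

text \<open>Parallel strands turn around in nested U-turns. The heads of \<open>X\<close> and
  \<open>Y\<close> are neighbours in \<open>rev X @ Y\<close>, so the turns are made from the inside
  out, one row for each. The condition on \<open>f\<close> says that on the remaining letters it
  identifies nothing but paired ones.\<close>

lemma word_grid_uturns:
  assumes "length X = length Y" "distinct (X @ Y)" "map f X = map f Y"
    and "\<And>z. z \<in> set X \<Longrightarrow> count_list (P @ rev X @ Y @ Q) z \<le> 2"
    and "\<And>z z'. \<lbrakk>z \<in> set (P @ Q); z' \<in> set (P @ Q); f z = f z'\<rbrakk>
      \<Longrightarrow> z = z' \<or> (z, z') \<in> set (zip X Y) \<or> (z', z) \<in> set (zip X Y)"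
    and "P @ Q \<noteq> []"
  shows "word_grid d (map f (P @ Q)) \<preceq> word_grid (d + length X) (P @ rev X @ Y @ Q)"
  using assms
proof (induction X Y arbitrary: P Q rule: list_induct2)
  case Nil
  have "inj_on f (set (P @ Q))"
    using Nil.prems by (auto simp: inj_on_def)
  then have "map (inv_into (set (P @ Q)) f) (map f (P @ Q)) = P @ Q"
    unfolding map_map by (intro map_idI) (simp add: inv_into_f_f)
  then have "subseq (map (inv_into (set (P @ Q)) f) (map f (P @ Q))) (P @ Q)"
    by (simp only: subseq_order.order_refl)
  from word_grid_subseq[OF this] show ?case
    using Nil.prems(5) by simp
next
  case (Cons x X y Y)
  \<comment> \<open>\<open>g\<close> is the renaming caused by the innermost turn; \<open>f\<close>
    factors through it because \<open>f x = f y\<close>.\<close>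
  define g where "g z = (if z = y then x else z)" for z
  have fg: "f (g z) = f z" for z
    using Cons.prems by (auto simp: g_def)
  have g_id: "map g (rev X @ Y) = rev X @ Y"
    using Cons.prems by (intro map_idI) (auto simp: g_def)
  let ?w = "P @ rev (x # X) @ (y # Y) @ Q"
  have 1: "word_grid d (map f (map g P @ map g Q)) \<preceq>
    word_grid (d + length X) (map g P @ rev X @ Y @ map g Q)"
  proof (rule Cons.IH)
    show "count_list (map g P @ rev X @ Y @ map g Q) z \<le> 2" if "z \<in> set X" for z
    proof -
      have "count_list (map g P) z = count_list P z" "count_list (map g Q) z = count_list Q z"
        using that Cons.prems
        by (auto simp: g_def count_list_eq_length_filter filter_map comp_def
            intro!: arg_cong[of _ _ length] filter_cong)
      then show ?thesis
        using that Cons.prems(3)[of z] by (auto split: if_splits)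
    qed
  next
    fix z z' assume z: "z \<in> set (map g P @ map g Q)" "z' \<in> set (map g P @ map g Q)" "f z = f z'"
    then obtain u u' where u: "u \<in> set (P @ Q)" "u' \<in> set (P @ Q)" "z = g u" "z' = g u'"
      by auto
    then have "f u = f u'"
      using z fg by metis
    then have "u = u' \<or> (u, u') \<in> set (zip (x # X) (y # Y)) \<or> (u', u) \<in> set (zip (x # X) (y # Y))"
      using Cons.prems u by blast
    moreover have "a \<noteq> y \<and> b \<noteq> y" if "(a, b) \<in> set (zip X Y)" for a b
      using set_zip_leftD[OF that] set_zip_rightD[OF that] Cons.prems(1) by auto
    ultimately show "z = z' \<or> (z, z') \<in> set (zip X Y) \<or> (z', z) \<in> set (zip X Y)"
      unfolding u(3,4) g_def by (elim disjE) auto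
  qed (use Cons.prems in auto)
  have 2: "map f (map g P @ map g Q) = map f (P @ Q)"
    using fg by simp
  have 3: "map g P @ rev X @ Y @ map g Q = map g ((P @ rev X) @ Y @ Q)"
    using g_id by simp
  have 4: "word_grid (d + length X) (map g ((P @ rev X) @ Y @ Q)) \<preceq>
    word_grid (Suc (d + length X)) ((P @ rev X) @ [x, y] @ Y @ Q)"
    unfolding g_def using Cons.prems(1,5) Cons.prems(3)[of x] by (intro word_grid_uturn) auto
  show ?case
    using minor_trans[OF 1[unfolded 2 3] 4] by simp
qed

section \<open>Ribbons\<close>

text \<open>A ribbon end \<open>(x, s)\<close> stands for one end of a bundle of parallel strands; \<open>s\<close> tells whether
  the strands are met in reverse order. So \<open>x \<dots> x\<close> is a twisted ribbon, and \<open>x \<dots> x\<^sup>-\<^sup>1\<close> is an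
  untwisted one.\<close>

definition strands :: "nat \<Rightarrow> 'l \<times> bool \<Rightarrow> ('l \<times> nat) list" where
  "strands w = (\<lambda>(x, s). map (Pair x) (if s then rev [0..<w] else [0..<w]))"

definition expand :: "nat \<Rightarrow> ('l \<times> bool) list \<Rightarrow> ('l \<times> nat) list" where
  "expand w bs = concat (map (strands w) bs)"

lemma expand_simps [simp]:
  "expand w [] = []" "expand w (b # bs) = strands w b @ expand w bs"
  "expand w (bs @ cs) = expand w bs @ expand w cs"
  by (simp_all add: expand_def)

lemma length_strands [simp]: "length (strands w b) = w"
  by (cases b) (simp add: strands_def)

lemma distinct_strands [simp]: "distinct (strands w b)"
  by (cases b) (simp add: strands_def distinct_map inj_on_def)

lemma set_strands: "set (strands w b) = {fst b} \<times> {..<w}"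
  by (cases b) (auto simp: strands_def)

lemma nth_strands: "i < w \<Longrightarrow> strands w (x, s) ! i = (x, if s then w - 1 - i else i)"
  by (simp add: strands_def rev_nth)

text \<open>Numbering the strands from the other side toggles the flag. This is the renaming when a
  turn joins two ends with equal flags.\<close>

lemma strands_flip: "map (\<lambda>(x, j). (y, w - 1 - j)) (strands w (x, s)) = strands w (y, \<not> s)"
  by (rule nth_equalityI) (auto simp: nth_strands)

lemma map_strands: "map (\<lambda>(x, j). (f x, j)) (strands w (x, s)) = strands w (f x, s)"
  by (rule nth_equalityI) (auto simp: nth_strands)

lemma map_expand: "map (\<lambda>(x, j). (f x, j)) (expand w bs) = expand w (map (\<lambda>(x, s). (f x, s)) bs)"
  by (induction bs) (auto simp: map_strands)

lemma set_expand: "(x, j) \<in> set (expand w bs) \<longleftrightarrow> x \<in> fst ` set bs \<and> j < w"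
  by (induction bs) (auto simp: set_strands)

lemma count_list_distinct: "distinct xs \<Longrightarrow> count_list xs x \<le> 1"
  by (induction xs) (auto simp: count_list_0_iff)

lemma count_list_expand: "count_list (expand w bs) (x, j) \<le> count_list (map fst bs) x"
proof (induction bs)
  case (Cons b bs)
  have "count_list (strands w b) (x, j) \<le> (if fst b = x then 1 else 0)"
    using count_list_distinct[OF distinct_strands[of w b], of "(x, j)"]
    by (auto simp: set_strands count_list_0_iff)
  then show ?case
    using Cons by (auto split: if_splits)
qed simp

text \<open>Nested turns pair the strands of neighbouring ends outwards from their common border.
  For \<open>s = t\<close> strand \<open>j\<close> meets strand \<open>w - 1 - j\<close>, so the
  surviving end of \<open>y\<close> is flipped; for different flags equal numbers meet. The
  definition is executable, so that slides can be checked by evaluation.\<close>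

definition turn :: "nat \<Rightarrow> ('l \<times> bool) list \<Rightarrow> ('l \<times> bool) list option" where
  "turn i bs = (case drop i bs of
     (x, s) # (y, t) # q \<Rightarrow>
       if x \<noteq> y \<and> count_list (map fst bs) x \<le> 2
       then Some (map (\<lambda>(z, r). if z = y then (x, if s = t then \<not> r else r) else (z, r)) (take i bs @ q))
       else None
   | _ \<Rightarrow> None)"

text \<open>Every turn removes two ends, and each position refers to the list left by the turns
  before it.\<close>

fun turns :: "nat list \<Rightarrow> ('l \<times> bool) list \<Rightarrow> ('l \<times> bool) list option" where
  "turns [] bs = Some bs"
| "turns (i # is) bs = (case turn i bs of None \<Rightarrow> None | Some cs \<Rightarrow> turns is cs)"

text \<open>A turn of ribbons of width \<open>w\<close> consists of \<open>w\<close> nested turns of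
  strands. \<open>Inl\<close> and \<open>Inr\<close> keep the letters of the surroundings apart from
  those being renamed, and \<open>P \<noteq> []\<close> keeps the word nonempty.\<close>

lemma word_grid_turn:
  assumes "turn i bs = Some cs" "P \<noteq> []"
  shows "word_grid d (map Inl P @ map Inr (expand w cs) @ map Inl Q) \<preceq>
    word_grid (d + w) (map Inl P @ map Inr (expand w bs) @ map Inl Q)"
proof -
  obtain x s y t q where q: "drop i bs = (x, s) # (y, t) # q"
    and ne: "x \<noteq> y" and cnt: "count_list (map fst bs) x \<le> 2"
    and cs: "cs = map (\<lambda>(z, r). if z = y then (x, if s = t then \<not> r else r) else (z, r)) (take i bs @ q)"
    using assms(1) by (auto simp: turn_def split: list.splits if_splits)
  define p where "p = take i bs"
  have bs: "bs = p @ (x, s) # (y, t) # q"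
    unfolding p_def q[symmetric] by simp
  \<comment> \<open>The effect on strands: a strand of \<open>y\<close> takes the name of its
    partner in \<open>x\<close>.\<close>
  define h where "h = (\<lambda>(z, j). if z = y then (x, if s = t then w - 1 - j else j) else (z, j))"
  define f where "f u = (case u of Inl z \<Rightarrow> Inl z | Inr u \<Rightarrow> Inr (h u))" for u :: "'b + 'a \<times> nat"
  let ?g = "\<lambda>(z, r). if z = y then (x, if s = t then \<not> r else r) else (z, r)"
  have h_strands: "map h (strands w b) = strands w (?g b)" for b
  proof (cases b)
    case (Pair z r)
    show ?thesis
    proof (cases "z = y")
      case False
      then have "map h (strands w b) = strands w b"
        by (intro map_idI) (auto simp: h_def Pair set_strands)
      then show ?thesis
        using Pair False by simp
    next
      case True
      show ?thesis
      proof (cases "s = t")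
        case True
        then have "map h (strands w b) = map (\<lambda>(z, j). (x, w - 1 - j)) (strands w b)"
          using \<open>z = y\<close> by (intro map_cong) (auto simp: h_def Pair set_strands)
        then show ?thesis
          unfolding Pair strands_flip using True \<open>z = y\<close> by simp
      next
        case False
        then have "map h (strands w b) = map (\<lambda>(z, j). (x, j)) (strands w b)"
          using \<open>z = y\<close> by (intro map_cong) (auto simp: h_def Pair set_strands)
        then show ?thesis
          unfolding Pair map_strands[of "\<lambda>_. x"] using False \<open>z = y\<close> by simp
      qed
    qed
  qed
  then have h_expand: "map h (expand w bs) = expand w (map ?g bs)" for bs
    by (induction bs) auto
  \<comment> \<open>The left strands are listed from the turn outwards, as
    \<open>word_grid_uturns\<close> expects.\<close>
  let ?X = "rev (map Inr (strands w (x, s))) :: ('b + 'a \<times> nat) list"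
  let ?Y = "map Inr (strands w (y, t)) :: ('b + 'a \<times> nat) list"
  let ?P = "map Inl P @ map Inr (expand w p)"
  let ?Q = "map Inr (expand w q) @ map Inl Q"
  have fR: "map f (map Inr u) = map Inr (map h u)" for u
    by (simp add: f_def)
  have fL: "map f (map Inl u) = map Inl u" for u
    by (simp add: f_def)
  have eq: "map f (?P @ ?Q) = map Inl P @ map Inr (expand w cs) @ map Inl Q"
    unfolding cs p_def[symmetric] map_append expand_simps fR fL h_expand append_assoc ..
  have "word_grid d (map f (?P @ ?Q)) \<preceq> word_grid (d + length ?X) (?P @ rev ?X @ ?Y @ ?Q)"
  proof (rule word_grid_uturns)
    show "distinct (?X @ ?Y)"
      using ne by (auto simp: distinct_map set_strands)
  next
    show "map f ?X = map f ?Y"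
      by (rule nth_equalityI) (use ne in \<open>auto simp: f_def h_def rev_nth nth_strands\<close>)
  next
    fix z assume "z \<in> set ?X"
    then obtain j where "z = Inr (x, j)"
      by (auto simp: set_strands)
    then have "count_list (?P @ rev ?X @ ?Y @ ?Q) z = count_list (expand w bs) (x, j)"
      unfolding bs by (simp add: count_list_map_conv count_notin image_iff)
    then show "count_list (?P @ rev ?X @ ?Y @ ?Q) z \<le> 2"
      using cnt count_list_expand[of w bs x j] by simp
  next
    fix z z' assume z: "z \<in> set (?P @ ?Q)" "z' \<in> set (?P @ ?Q)" "f z = f z'"
    have *: "(Inr (x, if s = t then w - 1 - j else j), Inr (y, j)) \<in> set (zip ?X ?Y)" if "j < w" for j
    proof -
      \<comment> \<open>The place of strand \<open>j\<close> of \<open>y\<close>, counted from the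
        turn; the same place in \<open>?X\<close> holds its partner.\<close>
      let ?i = "if t then w - 1 - j else j"
      have "?X ! ?i = Inr (x, if s = t then w - 1 - j else j)" "?Y ! ?i = Inr (y, j)"
        using that by (auto simp: rev_nth nth_strands)
      moreover have "?i < length ?X" "?i < length ?Y"
        using that by auto
      ultimately show ?thesis
        unfolding in_set_zip by (intro exI[of _ ?i]) simp
    qed
    show "z = z' \<or> (z, z') \<in> set (zip ?X ?Y) \<or> (z', z) \<in> set (zip ?X ?Y)"
    proof (cases "(\<exists>u. z = Inl u) \<or> (\<exists>u. z' = Inl u)")
      case True
      then show ?thesis
        using z(3) by (auto simp: f_def split: sum.splits)
    next
      case False
      then obtain a j a' j' where eq: "z = Inr (a, j)" "z' = Inr (a', j')"
        by (metis sum.exhaust surj_pair)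
      then have lt: "j < w" "j' < w"
        using z(1,2) by (auto simp: set_expand)
      have "h (a, j) = h (a', j')"
        using z(3) eq by (simp add: f_def)
      then show ?thesis
        using *[OF lt(1)] *[OF lt(2)] lt ne unfolding eq h_def by (auto split: if_splits)
    qed
  qed (use assms(2) in auto)
  from this[unfolded eq] show ?thesis
    using bs by simp
qed

lemma word_grid_turns:
  assumes "turns is bs = Some cs" "P \<noteq> []"
  shows "word_grid d (map Inl P @ map Inr (expand w cs) @ map Inl Q) \<preceq>
    word_grid (d + length is * w) (map Inl P @ map Inr (expand w bs) @ map Inl Q)"
  using assms(1)
proof (induction "is" arbitrary: bs)
  case Nil
  then show ?case
    by (simp add: minor_refl)
next
  case (Cons i "is")
  then obtain bs' where "turn i bs = Some bs'" "turns is bs' = Some cs"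
    by (auto split: option.splits)
  then show ?case
    using minor_trans[OF Cons.IH word_grid_turn[OF _ assms(2)]] by (simp add: add.commute add.left_commute)
qed

section \<open>Cutting ribbons lengthwise\<close>

definition cable :: "('l \<Rightarrow> nat) \<Rightarrow> ('l \<times> bool) list \<Rightarrow> (('l \<times> nat) \<times> bool) list" where
  "cable m bs = concat (map (\<lambda>(x, s).
     map (\<lambda>a. ((x, a), s)) (if s then rev [0..<m x] else [0..<m x])) bs)"

lemma expand_upt: "concat (map (\<lambda>a. map (\<lambda>j. a * w + j) [0..<w]) [0..<m]) = [0..<m * w]"
proof (induction m)
  case (Suc m)
  have "map (\<lambda>j. m * w + j) [0..<w] = [m * w..<m * w + w]"
    by (simp add: add.commute map_add_upt)
  then show ?case
    using Suc upt_add_eq_append[of 0 "m * w" w] by (simp add: add.commute)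
qed simp

text \<open>Strand \<open>j\<close> of the part \<open>a\<close> is strand \<open>a * w + j\<close>
  of the uncut ribbon. At a reversed end both the parts and the strands in each part come in reverse
  order, which again matches.\<close>

lemma expand_cable:
  "map (\<lambda>((x, a), j). (x, a * w + j)) (expand w (cable m bs)) =
    concat (map (\<lambda>(x, s). strands (m x * w) (x, s)) bs)"
proof (induction bs)
  case Nil
  then show ?case
    by (simp add: cable_def)
next
  case (Cons b bs)
  obtain x s where b: "b = (x, s)"
    by fastforce
  have "map (\<lambda>((x, a), j). (x, a * w + j)) (expand w (cable m [b])) = strands (m x * w) (x, s)"
  proof (cases s)
    case False
    then show ?thesis
      unfolding b strands_def expand_upt[symmetric]
      by (simp add: expand_def cable_def strands_def map_concat comp_def)
  next
    case True
    then show ?thesis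
      unfolding b strands_def expand_upt[symmetric]
      by (simp add: expand_def cable_def strands_def map_concat rev_concat rev_map comp_def)
  qed
  moreover have "cable m (b # bs) = cable m [b] @ cable m bs"
    by (simp add: cable_def)
  ultimately show ?case
    using Cons b by simp
qed

text \<open>Both orientations keep the strands numbered below \<open>w\<close>, so the two ends of a
  ribbon are thinned consistently.\<close>

lemma subseq_strands: "w \<le> w' \<Longrightarrow> subseq (strands w b) (strands w' b)"
proof (cases b)
  case (Pair x s)
  assume "w \<le> w'"
  then have "[0..<w'] = [0..<w] @ [w..<w']"
    by (metis le_add_diff_inverse upt_add_eq_append zero_le)
  then show ?thesis
    using Pair by (auto simp: strands_def)
qed

lemma subseq_concat_map:
  "(\<And>x. x \<in> set xs \<Longrightarrow> subseq (f x) (g x)) \<Longrightarrow> subseq (concat (map f xs)) (concat (map g xs))"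
  by (induction xs) (auto intro!: list_emb_append_mono)

lemma subseq_expand: "w \<le> w' \<Longrightarrow> subseq (expand w bs) (expand w' bs)"
  unfolding expand_def by (intro subseq_concat_map subseq_strands)

lemma subseq_cable:
  assumes "\<And>x. m x \<le> n"
  shows "subseq (map (\<lambda>((x, a), j). (x, a * w + j)) (expand w (cable m bs))) (expand (n * w) bs)"
  unfolding expand_cable expand_def[of "n * w"] using assms
  by (intro subseq_concat_map) (auto intro: subseq_strands)

section \<open>Surface grids as words\<close>

datatype piece = Blank | Crosscap | Handle

text \<open>The ribbon \<open>(n, b)\<close> belongs to the block with index \<open>n\<close>, and
  \<open>b\<close> separates the two ribbons of a handle. A blank block is one ribbon end without
  partner: it fills its columns but has no chords.\<close>

fun piece_ribbons :: "nat \<Rightarrow> piece \<Rightarrow> ((nat \<times> bool) \<times> bool) list" where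
  "piece_ribbons n Blank = [((n, False), False)]"
| "piece_ribbons n Crosscap = [((n, False), False), ((n, False), False)]"
| "piece_ribbons n Handle =
    [((n, False), False), ((n, True), False), ((n, False), True), ((n, True), True)]"

text \<open>Chosen so that every block has \<open>4 * k\<close> columns, the spacing of the
  positions in \<open>surface_grid\<close>.\<close>

fun piece_width :: "nat \<Rightarrow> piece \<Rightarrow> nat" where
  "piece_width k Blank = 4 * k"
| "piece_width k Crosscap = 2 * k"
| "piece_width k Handle = k"

fun ribbons :: "nat \<Rightarrow> piece list \<Rightarrow> ((nat \<times> bool) \<times> bool) list" where
  "ribbons n [] = []"
| "ribbons n (q # qs) = piece_ribbons n q @ ribbons (Suc n) qs"

fun pieces_word :: "nat \<Rightarrow> nat \<Rightarrow> piece list \<Rightarrow> ((nat \<times> bool) \<times> nat) list" where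
  "pieces_word k n [] = []"
| "pieces_word k n (q # qs) = expand (piece_width k q) (piece_ribbons n q) @ pieces_word k (Suc n) qs"

lemma pieces_word_append:
  "pieces_word k n (A @ B) = pieces_word k n A @ pieces_word k (n + length A) B"
  by (induction A arbitrary: n) auto

lemma pieces_word_nonempty: "\<lbrakk>0 < k; qs \<noteq> []\<rbrakk> \<Longrightarrow> pieces_word k n qs \<noteq> []"
proof (cases qs)
  case (Cons q qs')
  assume "0 < k"
  then show ?thesis
    unfolding Cons by (cases q) (auto simp: strands_def)
qed simp

lemma pieces_word_index:
  "x \<in> set (pieces_word k n qs) \<Longrightarrow> n \<le> fst (fst x) \<and> fst (fst x) < n + length qs"
proof (induction qs arbitrary: n)
  case (Cons q qs)
  then show ?case
    by (cases q) (fastforce simp: set_strands)+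
qed simp

lemma pieces_word_relabel:
  assumes "\<And>i. i < length qs \<Longrightarrow> h (n + i) = n' + i"
  shows "map (\<lambda>((i, b), j). ((h i, b), j)) (pieces_word k n qs) = pieces_word k n' qs"
  using assms
proof (induction qs arbitrary: n n')
  case (Cons q qs)
  have "h n = n'"
    using Cons.prems[of 0] by simp
  then have "map (\<lambda>((i, b), j). ((h i, b), j)) (expand (piece_width k q) (piece_ribbons n q)) =
      expand (piece_width k q) (piece_ribbons n' q)"
    by (cases q) (auto simp: strands_def)
  moreover have "h (Suc n + i) = Suc n' + i" if "i < length qs" for i
    using Cons.prems[of "Suc i"] that by simp
  ultimately show ?case
    using Cons.IH[of "Suc n" "Suc n'"] by simp
qed simp

lemma piece_width_bounds: "k \<le> piece_width k q" "q \<noteq> Blank \<Longrightarrow> piece_width k q \<le> 2 * k"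
  by (cases q; simp)+

lemma piece_width_mono: "k \<le> k' \<Longrightarrow> piece_width k q \<le> piece_width k' q"
  by (cases q) auto

lemma subseq_pieces_word_mono: "k \<le> k' \<Longrightarrow> subseq (pieces_word k n qs) (pieces_word k' n qs)"
  by (induction qs arbitrary: n) (auto intro!: list_emb_append_mono subseq_expand piece_width_mono)

text \<open>Turns need one width for all ribbons. Words with individual widths contain the pattern
  with uniform width \<open>k\<close>, and without blank blocks they are contained in the one with
  width \<open>2 * k\<close>.\<close>

lemma subseq_expand_ribbons: "w \<le> k \<Longrightarrow> subseq (expand w (ribbons n qs)) (pieces_word k n qs)"
  by (induction qs arbitrary: n)
    (auto intro!: list_emb_append_mono subseq_expand intro: le_trans piece_width_bounds(1))

lemma subseq_pieces_word_expand:
  "\<lbrakk>Blank \<notin> set qs; 2 * k \<le> w\<rbrakk> \<Longrightarrow> subseq (pieces_word k n qs) (expand w (ribbons n qs))"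
proof (induction qs arbitrary: n)
  case (Cons q qs)
  then have "piece_width k q \<le> w"
    using piece_width_bounds(2)[of q k] by auto
  then show ?case
    using Cons by (auto intro!: list_emb_append_mono subseq_expand)
qed simp

section \<open>Replacing blocks of pieces\<close>

lemma word_grid_pieces_mono:
  assumes "k \<le> k'" "0 < k" "qs \<noteq> []"
  shows "word_grid k (pieces_word k 0 qs) \<preceq> word_grid k' (pieces_word k' 0 qs)"
proof -
  have "word_grid k (pieces_word k 0 qs) \<preceq> word_grid k (pieces_word k' 0 qs)"
    using subseq_pieces_word_mono[OF assms(1)] pieces_word_nonempty[OF assms(2,3)]
    by (intro word_grid_subseq[of id]) auto
  then show ?thesis
    using word_grid_mono_depth[OF assms(1)] minor_trans by blast
qed

text \<open>Every ribbon of \<open>X\<close> is cut lengthwise into at most six parallel ribbons of width \<open>2 k\<close>; the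
  turns then join these end to end to the ribbons of \<open>Y\<close>.\<close>

lemma word_grid_replace_pieces:
  assumes turns: "turns is (cable m (ribbons 0 X)) = Some (map (\<lambda>(x, s). (f x, s)) (ribbons 0 Y))"
    and m: "\<And>x. m x \<le> 6" and Y: "Blank \<notin> set Y" and A: "A \<noteq> []" and k: "0 < k"
    and K: "(2 * length is + 1) * k \<le> K" "12 * k \<le> K"
  shows "word_grid k (pieces_word k 0 (A @ Y @ B)) \<preceq> word_grid K (pieces_word K 0 (A @ X @ B))"
proof -
  let ?n = "length A" and ?x = "length X" and ?y = "length Y"
  let ?P = "pieces_word k 0 A" and ?Q = "pieces_word k (?n + ?y) B"
  let ?V = "\<lambda>bs. map Inl ?P @ map Inr (expand (2 * k) bs) @ map Inl ?Q"
  have P: "?P \<noteq> []"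
    using k A by (rule pieces_word_nonempty)
  have 1: "word_grid k (pieces_word k 0 (A @ Y @ B)) \<preceq> word_grid k (?V (map (\<lambda>(x, s). (f x, s)) (ribbons 0 Y)))"
  proof (rule word_grid_subseq)
    \<comment> \<open>Letters of the block \<open>Y\<close> go to \<open>Inr\<close> with the names
      that result from the turns; the surroundings go to \<open>Inl\<close>.\<close>
    define t where "t = (\<lambda>((i, b), j :: nat). if ?n \<le> i \<and> i < ?n + ?y then Inr (f (i - ?n, b), j)
      else Inl ((i, b), j))"
    have tP: "map t ?P = map Inl ?P" and tQ: "map t ?Q = map Inl ?Q"
      by (auto simp: t_def dest!: pieces_word_index)
    have "map t (pieces_word k ?n Y) = map Inr (map (\<lambda>(x, j). (f x, j))
        (map (\<lambda>((i, b), j). ((i - ?n, b), j)) (pieces_word k ?n Y)))"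
      by (auto simp: t_def dest!: pieces_word_index)
    also have "map (\<lambda>((i, b), j). ((i - ?n, b), j)) (pieces_word k ?n Y) = pieces_word k 0 Y"
      by (rule pieces_word_relabel) simp
    finally have tY: "map t (pieces_word k ?n Y) = map Inr (map (\<lambda>(x, j). (f x, j)) (pieces_word k 0 Y))" .
    have "subseq (map (\<lambda>(x, j). (f x, j)) (pieces_word k 0 Y))
        (expand (2 * k) (map (\<lambda>(x, s). (f x, s)) (ribbons 0 Y)))"
      unfolding map_expand[symmetric] by (intro subseq_map subseq_pieces_word_expand Y) simp
    then show "subseq (map t (pieces_word k 0 (A @ Y @ B)))
        (?V (map (\<lambda>(x, s). (f x, s)) (ribbons 0 Y)))"
      unfolding pieces_word_append map_append add_0 tP tQ tY
      by (intro list_emb_append_mono subseq_map subseq_order.order_refl)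
  qed (use P in \<open>simp add: pieces_word_append\<close>)
  have 2: "word_grid k (?V (map (\<lambda>(x, s). (f x, s)) (ribbons 0 Y))) \<preceq>
    word_grid (k + length is * (2 * k)) (?V (cable m (ribbons 0 X)))"
    by (rule word_grid_turns[OF turns P])
  \<comment> \<open>Each turn uses \<open>2 * k\<close> rows and \<open>k\<close> rows must remain,
    hence the bound \<open>(2 * length is + 1) * k\<close>.\<close>
  have 3: "word_grid (k + length is * (2 * k)) (?V (cable m (ribbons 0 X))) \<preceq>
    word_grid K (?V (cable m (ribbons 0 X)))"
    using K(1) by (intro word_grid_mono_depth) (simp add: algebra_simps)
  have 4: "word_grid K (?V (cable m (ribbons 0 X))) \<preceq> word_grid K (pieces_word K 0 (A @ X @ B))"
  proof (rule word_grid_subseq)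
    \<comment> \<open>The blocks of \<open>B\<close> are renumbered, because \<open>X\<close> and
      \<open>Y\<close> may differ in length.\<close>
    define h where "h i = (if i < ?n then i else i - ?y + ?x)" for i
    define t where "t u = (case u of Inl ((i, b :: bool), j) \<Rightarrow> ((h i, b), j)
      | Inr (((i, b), a), j) \<Rightarrow> ((i + ?n, b), a * (2 * k) + j))" for u
    have tL: "map t (map Inl u) = map (\<lambda>((i, b), j). ((h i, b), j)) u" for u
      by (auto simp: t_def split: prod.split)
    have tP: "map t (map Inl ?P) = ?P"
      unfolding tL by (rule pieces_word_relabel) (simp add: h_def)
    have tQ: "map t (map Inl ?Q) = pieces_word k (?n + ?x) B"
      unfolding tL by (rule pieces_word_relabel) (simp add: h_def)
    have tX: "map t (map Inr u) = map (\<lambda>((i, b), j). ((i + ?n, b), j))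
        (map (\<lambda>((x, a), j). (x, a * (2 * k) + j)) u)" for u
      by (auto simp: t_def split: prod.split)
    have X: "subseq (map (\<lambda>((i, b), j). ((i + ?n, b), j)) (map (\<lambda>((x, a), j). (x, a * (2 * k) + j))
        (expand (2 * k) (cable m (ribbons 0 X))))) (pieces_word K ?n X)"
    proof -
      \<comment> \<open>Six ribbons of width \<open>2 * k\<close> fit into width
        \<open>12 * k \<le> K\<close>, and every ribbon of \<open>X\<close> has width at least
        \<open>K\<close>.\<close>
      have "subseq (map (\<lambda>((x, a), j). (x, a * (2 * k) + j)) (expand (2 * k) (cable m (ribbons 0 X))))
          (expand (6 * (2 * k)) (ribbons 0 X))"
        by (rule subseq_cable[OF m])
      also have "subseq \<dots> (pieces_word K 0 X)"
        using K(2) by (intro subseq_expand_ribbons) simp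
      finally have "subseq (map (\<lambda>((i, b), j). ((i + ?n, b), j))
          (map (\<lambda>((x, a), j). (x, a * (2 * k) + j)) (expand (2 * k) (cable m (ribbons 0 X)))))
          (map (\<lambda>((i, b), j). ((i + ?n, b), j)) (pieces_word K 0 X))"
        by (rule subseq_map)
      also have "map (\<lambda>((i, b), j). ((i + ?n, b), j)) (pieces_word K 0 X) = pieces_word K ?n X"
        by (rule pieces_word_relabel) simp
      finally show ?thesis .
    qed
    have "k \<le> K"
      using K(2) by simp
    then show "subseq (map t (?V (cable m (ribbons 0 X)))) (pieces_word K 0 (A @ X @ B))"
      unfolding pieces_word_append map_append add_0 tP tQ tX
      by (intro list_emb_append_mono subseq_pieces_word_mono X)
  qed (use P in simp)
  show ?thesis
    using minor_trans[OF minor_trans[OF 1 2] minor_trans[OF 3 4]] .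
qed

text \<open>The positions below realise sequences of handle slides: an end of a ribbon \<open>x\<close> slides over a
  neighbouring ribbon \<open>y\<close> when all strands of \<open>x\<close> are joined to the nearest strands of \<open>y\<close>. The
  multiplicities in \<open>cable\<close> count how often the resulting ribbons run along an original one.\<close>

lemma turns_crosscaps_from_crosscap_handle:
  "turns [5, 4, 3, 3, 5, 2, 1, 3]
    (cable (\<lambda>x. if x = (0, False) then 3 else 4) (ribbons 0 [Crosscap, Handle])) =
    Some (map (\<lambda>(x, s). (((0, False), fst x), s)) (ribbons 0 [Crosscap, Crosscap, Crosscap]))"
  by code_simp

text \<open>Cutting the crosscap into three and both ribbons of the handle into four gives 22 ends.
  Eight turns remove 16 and leave the six ends of three crosscaps.\<close>

lemma turns_crosscaps_from_handle_crosscap: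
  "turns [15, 14, 13, 7, 3, 7, 6, 5]
    (cable (\<lambda>x. if x = (1, False) then 3 else 4) (ribbons 0 [Handle, Crosscap])) =
    Some (map (\<lambda>(x, s). (((0, fst x = 2), if fst x = 0 then 1 else 2), s))
      (ribbons 0 [Crosscap, Crosscap, Crosscap]))"
  by code_simp

text \<open>The way back: cutting into 6, 2 and 3 ribbons again gives 22 ends, of which eight turns
  leave two for the crosscap and four for the handle.\<close>

lemma turns_crosscap_handle_from_crosscaps:
  "turns [11, 10, 11, 10, 9, 8, 7, 5]
    (cable (\<lambda>x. if fst x = 0 then 6 else if fst x = 1 then 2 else 3) (ribbons 0 [Crosscap, Crosscap, Crosscap])) =
    Some (map (\<lambda>(x, s). (((0, False), if x = (0, False) then 1 else if snd x then 3 else 2), s))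
      (ribbons 0 [Crosscap, Handle]))"
  by code_simp

text \<open>With the handle on the left, the first and the third crosscap exchange their
  multiplicities.\<close>

lemma turns_handle_crosscap_from_crosscaps:
  "turns [5, 4, 5, 4, 3, 2, 1, 1]
    (cable (\<lambda>x. if fst x = 0 then 3 else if fst x = 1 then 2 else 6) (ribbons 0 [Crosscap, Crosscap, Crosscap])) =
    Some (map (\<lambda>(x, s). (((2 * fst x, False), if fst x = 1 then 5 else if snd x then 2 else 0), s))
      (ribbons 0 [Handle, Crosscap]))"
  by code_simp

section \<open>Trading handles for crosscaps\<close>

text \<open>The constant is \<open>17 = 2 * 8 + 1\<close> for the rows used by eight turns; it also
  exceeds the 12 required for the widths.\<close>

lemma crosscaps_handle_exchange:
  assumes U: "U = [Crosscap, Handle] \<or> U = [Handle, Crosscap]" and A: "A \<noteq> []"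
    and k: "0 < k" "17 * k \<le> K"
  defines "V \<equiv> [Crosscap, Crosscap, Crosscap]"
  shows "word_grid k (pieces_word k 0 (A @ V @ B)) \<preceq> word_grid K (pieces_word K 0 (A @ U @ B))"
    and "word_grid k (pieces_word k 0 (A @ U @ B)) \<preceq> word_grid K (pieces_word K 0 (A @ V @ B))"
proof -
  show "word_grid k (pieces_word k 0 (A @ V @ B)) \<preceq> word_grid K (pieces_word K 0 (A @ U @ B))"
    using U unfolding V_def
  proof
    assume "U = [Crosscap, Handle]"
    then show "word_grid k (pieces_word k 0 (A @ [Crosscap, Crosscap, Crosscap] @ B)) \<preceq>
        word_grid K (pieces_word K 0 (A @ U @ B))"
      by (simp only:, intro word_grid_replace_pieces[OF turns_crosscaps_from_crosscap_handle])
        (use A k in auto)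
  next
    assume "U = [Handle, Crosscap]"
    then show "word_grid k (pieces_word k 0 (A @ [Crosscap, Crosscap, Crosscap] @ B)) \<preceq>
        word_grid K (pieces_word K 0 (A @ U @ B))"
      by (simp only:, intro word_grid_replace_pieces[OF turns_crosscaps_from_handle_crosscap])
        (use A k in auto)
  qed
  show "word_grid k (pieces_word k 0 (A @ U @ B)) \<preceq> word_grid K (pieces_word K 0 (A @ V @ B))"
    using U unfolding V_def
  proof
    assume "U = [Crosscap, Handle]"
    then show "word_grid k (pieces_word k 0 (A @ U @ B)) \<preceq>
        word_grid K (pieces_word K 0 (A @ [Crosscap, Crosscap, Crosscap] @ B))"
      by (simp only:, intro word_grid_replace_pieces[OF turns_crosscap_handle_from_crosscaps])
        (use A k in auto)
  next
    assume "U = [Handle, Crosscap]"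
    then show "word_grid k (pieces_word k 0 (A @ U @ B)) \<preceq>
        word_grid K (pieces_word K 0 (A @ [Crosscap, Crosscap, Crosscap] @ B))"
      by (simp only:, intro word_grid_replace_pieces[OF turns_handle_crosscap_from_crosscaps])
        (use A k in auto)
  qed
qed

lemma adjacent_crosscap_handle:
  "\<lbrakk>Crosscap \<in> set qs; Handle \<in> set qs; Blank \<notin> set qs\<rbrakk> \<Longrightarrow>
    \<exists>A U B. qs = A @ U @ B \<and> (U = [Crosscap, Handle] \<or> U = [Handle, Crosscap])"
proof (induction qs)
  case (Cons q qs)
  show ?case
  proof (cases "Crosscap \<in> set qs \<and> Handle \<in> set qs")
    case True
    then obtain A U B where "qs = A @ U @ B" "U = [Crosscap, Handle] \<or> U = [Handle, Crosscap]"
      using Cons by auto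
    then show ?thesis
      by (intro exI[of _ "q # A"] exI[of _ U] exI[of _ B]) simp
  next
    case False
    \<comment> \<open>The tail has only one kind of piece and \<open>q\<close> is the other kind, so
      the change happens at the front.\<close>
    then obtain q' qs' where qs: "qs = q' # qs'" "q' \<noteq> q"
      using Cons.prems by (cases qs) auto
    moreover have "q \<noteq> Blank" "q' \<noteq> Blank"
      using Cons.prems qs by auto
    ultimately have "[q, q'] = [Crosscap, Handle] \<or> [q, q'] = [Handle, Crosscap]"
      by (cases q; cases q') auto
    then show ?thesis
      using qs by (intro exI[of _ "[]"] exI[of _ "[q, q']"] exI[of _ qs']) simp
  qed
qed simp

text \<open>Induction on the number of handles. An exchange replaces a crosscap and a handle by
  three crosscaps, so \<open>length qs + n\<close> is invariant and crosscaps remain for the next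
  exchange. Each exchange costs a factor 17 in either direction.\<close>

lemma word_grid_pieces_crosscaps:
  assumes "Crosscap \<in> set qs" "Blank \<notin> set qs" "count_list qs Handle = n" "0 < k" "17 ^ n * k \<le> K"
  defines "cs \<equiv> replicate (length qs + n) Crosscap"
  shows "word_grid k (pieces_word k 0 (Blank # cs)) \<preceq> word_grid K (pieces_word K 0 (Blank # qs)) \<and>
    word_grid k (pieces_word k 0 (Blank # qs)) \<preceq> word_grid K (pieces_word K 0 (Blank # cs))"
  using assms(1-5) unfolding cs_def
proof (induction n arbitrary: qs k K)
  case 0
  have "q = Crosscap" if "q \<in> set qs" for q
    using 0 that by (cases q) (auto simp: count_list_0_iff)
  then have "replicate (length qs + 0) Crosscap = qs"
    by (simp add: replicate_length_same)
  then show ?case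
    using 0 word_grid_pieces_mono[of k K "Blank # qs"] by simp
next
  case (Suc n)
  have "Handle \<in> set qs"
    using Suc.prems(3) count_notin by fastforce
  then obtain A U B where qs: "qs = A @ U @ B" and U: "U = [Crosscap, Handle] \<or> U = [Handle, Crosscap]"
    using adjacent_crosscap_handle Suc.prems(1,2) by blast
  define qs' where "qs' = A @ [Crosscap, Crosscap, Crosscap] @ B"
  have IH: "word_grid j (pieces_word j 0 (Blank # replicate (length qs + Suc n) Crosscap)) \<preceq>
      word_grid J (pieces_word J 0 (Blank # qs')) \<and> word_grid j (pieces_word j 0 (Blank # qs')) \<preceq>
      word_grid J (pieces_word J 0 (Blank # replicate (length qs + Suc n) Crosscap))"
    if "0 < j" "17 ^ n * j \<le> J" for j J
  proof -
    have "count_list qs' Handle = n" "length qs' + n = length qs + Suc n"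
      using Suc.prems(3) U unfolding qs qs'_def by auto
    moreover have "Crosscap \<in> set qs'" "Blank \<notin> set qs'"
      using Suc.prems(2) unfolding qs qs'_def by auto
    ultimately show ?thesis
      using Suc.IH[of qs' j J] that by simp
  qed
  \<comment> \<open>Towards \<open>qs\<close> the exchange comes last, from order
    \<open>17 ^ n * k\<close> to \<open>K\<close>; away from \<open>qs\<close> it comes first, from
    \<open>k\<close> to \<open>17 * k\<close>.\<close>
  have 1: "word_grid (17 ^ n * k) (pieces_word (17 ^ n * k) 0 (Blank # qs')) \<preceq>
      word_grid K (pieces_word K 0 (Blank # qs))"
    using crosscaps_handle_exchange(1)[OF U, of "Blank # A" "17 ^ n * k" K B] Suc.prems
    unfolding qs qs'_def by simp
  have 2: "word_grid k (pieces_word k 0 (Blank # qs)) \<preceq>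
      word_grid (17 * k) (pieces_word (17 * k) 0 (Blank # qs'))"
    using crosscaps_handle_exchange(2)[OF U, of "Blank # A" k "17 * k" B] Suc.prems
    unfolding qs qs'_def by simp
  have "17 ^ n * (17 * k) \<le> K"
    using Suc.prems(5) by (simp add: mult.assoc mult.left_commute)
  then show ?case
    using minor_trans[OF conjunct1[OF IH[of k "17 ^ n * k"]] 1]
      minor_trans[OF 2 conjunct2[OF IH[of "17 * k" K]]] Suc.prems(4) by simp
qed

section \<open>Mixed surface grids\<close>

text \<open>The chords inside one block, with offsets counted from 0 and the smaller end first. It
  mediates between the index formulas of the grids and the words.\<close>

fun piece_chord :: "nat \<Rightarrow> piece \<Rightarrow> nat \<Rightarrow> nat \<Rightarrow> bool" where
  "piece_chord k Blank r r' \<longleftrightarrow> False"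
| "piece_chord k Crosscap r r' \<longleftrightarrow> r < 2 * k \<and> r' = r + 2 * k"
| "piece_chord k Handle r r' \<longleftrightarrow>
    r < k \<and> r' = 3 * k - 1 - r \<or> k \<le> r \<and> r < 2 * k \<and> r' = 5 * k - 1 - r"

lemma piece_chord_less: "piece_chord k q r r' \<Longrightarrow> r < r' \<and> r' < 4 * k"
  by (cases q) auto

section \<open>Locating the chords of a word\<close>

lemma length_expand: "length (expand w bs) = length bs * w"
  by (induction bs) auto

lemma length_piece: "length (expand (piece_width k q) (piece_ribbons n q)) = 4 * k"
  by (cases q) (auto simp: length_expand)

text \<open>Two ends with equal flags link offsets at the constant distance \<open>2 * k\<close>;
  opposite flags link offsets with constant sum, \<open>3 * k - 1\<close> for the first and
  \<open>5 * k - 1\<close> for the second ribbon of a handle.\<close>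

lemma piece_chord_iff:
  assumes "r < r'" "r' < 4 * k"
  shows "expand (piece_width k q) (piece_ribbons n q) ! r =
    expand (piece_width k q) (piece_ribbons n q) ! r' \<longleftrightarrow> piece_chord k q r r'"
proof (cases q)
  case Blank
  then show ?thesis
    using assms by (simp add: nth_strands)
next
  case Crosscap
  have "expand (piece_width k q) (piece_ribbons n q) ! i =
      ((n, False), if i < 2 * k then i else i - 2 * k)" if "i < 4 * k" for i
    using that Crosscap by (auto simp: nth_append nth_strands)
  then show ?thesis
    using assms Crosscap by auto
next
  case Handle
  have "expand (piece_width k q) (piece_ribbons n q) ! i =
      (if i < k then ((n, False), i) else if i < 2 * k then ((n, True), i - k)
       else if i < 3 * k then ((n, False), 3 * k - 1 - i) else ((n, True), 4 * k - 1 - i))"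
    if "i < 4 * k" for i
    using that Handle by (auto simp: nth_append nth_strands)
  then show ?thesis
    using assms Handle by auto
qed

lemma length_pieces_word: "length (pieces_word k n qs) = 4 * k * length qs"
  by (induction qs arbitrary: n) (auto simp: length_piece)

lemma nth_pieces_word:
  "\<lbrakk>i < length qs; r < 4 * k\<rbrakk> \<Longrightarrow> pieces_word k n qs ! (4 * k * i + r) =
    expand (piece_width k (qs ! i)) (piece_ribbons (n + i) (qs ! i)) ! r"
proof (induction qs arbitrary: n i)
  case (Cons q qs)
  then show ?case
    by (cases i) (auto simp: nth_append length_piece)
qed simp

text \<open>Every letter contains the index of its block, so linked columns lie in the same block.
  Division by \<open>4 * k\<close> splits a column into block and offset.\<close>

lemma linked_pieces_word:
  "{{(1 :: nat, x), (1 :: nat, y)} | x y. linked (pieces_word k 0 qs) x y} =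
    (\<Union>i<length qs. {{(1, 4 * k * i + r + 1), (1, 4 * k * i + r' + 1)} | r r'. piece_chord k (qs ! i) r r'})"
  (is "?L = ?R")
proof
  let ?w = "pieces_word k 0 qs"
  show "?R \<subseteq> ?L"
  proof clarify
    fix i r r' assume i: "i < length qs" and r: "piece_chord k (qs ! i) r r'"
    have "r < r'" "r' < 4 * k"
      using piece_chord_less[OF r] by auto
    moreover from i have "4 * k * i + 4 * k \<le> 4 * k * length qs"
      by (metis Suc_leI add.commute mult_Suc_right mult_le_mono2)
    ultimately have "linked ?w (4 * k * i + r + 1) (4 * k * i + r' + 1)"
      using i r piece_chord_iff[of r r' k "qs ! i" i] by (auto simp: linked_def length_pieces_word nth_pieces_word)
    then show "\<exists>x y. {(1 :: nat, 4 * k * i + r + 1), (1 :: nat, 4 * k * i + r' + 1)} = {(1, x), (1, y)} \<and> linked ?w x y"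
      by blast
  qed
  have "{(1, x), (1, y)} \<in> ?R" if "linked ?w x y" "x < y" for x y :: nat
  proof -
    define i r i' r' where ir: "i = (x - 1) div (4 * k)" "r = (x - 1) mod (4 * k)"
      "i' = (y - 1) div (4 * k)" "r' = (y - 1) mod (4 * k)"
    have xy: "1 \<le> x" "y \<le> 4 * k * length qs" "?w ! (x - 1) = ?w ! (y - 1)"
      using that(1) by (auto simp: linked_def length_pieces_word)
    have x: "x - 1 = 4 * k * i + r" and y: "y - 1 = 4 * k * i' + r'"
      by (simp_all add: ir)
    have "0 < k"
      using xy that(2) by (cases k) auto
    then have r: "r < 4 * k" "r' < 4 * k"
      by (simp_all add: ir)
    have i: "i < length qs" "i' < length qs"
      using xy that(2) unfolding ir by (auto simp: div_less_iff_less_mult mult.commute \<open>0 < k\<close>)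
    have idx: "fst (fst (?w ! (4 * k * j + s))) = j" if "j < length qs" "s < 4 * k" for j s
    proof -
      have "?w ! (4 * k * j + s) \<in> set (expand (piece_width k (qs ! j)) (piece_ribbons j (qs ! j)))"
        using nth_pieces_word[OF that, of 0] that(2) length_piece[of k "qs ! j" j]
        by (metis add_0 nth_mem)
      then show ?thesis
        by (cases "qs ! j") (auto simp: set_strands)
    qed
    have "i = i'"
      using xy(3) idx[OF i(1) r(1)] idx[OF i(2) r(2)] unfolding x y by simp
    moreover have "x - 1 < y - 1"
      using that(2) xy(1) by simp
    ultimately have "r < r'"
      unfolding x y by simp
    then have "piece_chord k (qs ! i) r r'"
      using xy(3) nth_pieces_word[OF i(1) r(1), of 0] nth_pieces_word[OF i(1) r(2), of 0] \<open>i = i'\<close>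
        piece_chord_iff[of r r' k "qs ! i" i] r unfolding x y by simp
    moreover have "x = 4 * k * i + r + 1" "y = 4 * k * i + r' + 1"
      using x y xy(1) that(2) \<open>i = i'\<close> by simp_all
    ultimately show ?thesis
      using i(1) by blast
  qed
  moreover have "linked ?w y x \<and> x \<noteq> y" if "linked ?w x y" for x y
    using that by (auto simp: linked_def)
  ultimately show "?L \<subseteq> ?R"
    by (smt (verit) insert_commute linorder_neqE_nat mem_Collect_eq subsetI)
qed

section \<open>Surface grids as word grids\<close>

lemma crosscap_edges_eq:
  "crosscap_edges k (Suc i) =
    {{(1, 4 * k * i + r + 1), (1, 4 * k * i + r' + 1)} | r r'. piece_chord k Crosscap r r'}"
proof -
  have "crosscap_edges k (Suc i) = (\<lambda>j. {(1, 4 * k * i + j), (1, 4 * k * i + 2 * k + j)}) ` {1..2 * k}"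
    unfolding crosscap_edges_def Let_def atLeastAtMost_def atLeast_def atMost_def
    by (simp, blast)
  also have "{1..2 * k} = Suc ` {..<2 * k}"
    by (simp add: image_Suc_lessThan)
  finally show ?thesis
    by (auto simp: image_image add_ac)
qed

lemma handle_edges_eq:
  "handle_edges k (Suc i) =
    {{(1, 4 * k * i + r + 1), (1, 4 * k * i + r' + 1)} | r r'. piece_chord k Handle r r'}"
proof -
  let ?b = "4 * k * i"
  have "handle_edges k (Suc i) = (\<lambda>j. {(1, ?b + j), (1, ?b + 3 * k - j + 1)}) ` {1..k} \<union>
      (\<lambda>j. {(1, ?b + k + j), (1, ?b + 4 * k - j + 1)}) ` {1..k}"
    unfolding handle_edges_def Let_def atLeastAtMost_def atLeast_def atMost_def
    by (simp, blast)
  also have "{1..k} = Suc ` {..<k}"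
    by (simp add: image_Suc_lessThan)
  also have "(\<lambda>j. {(1, ?b + j), (1, ?b + 3 * k - j + 1)}) ` Suc ` {..<k} =
      (\<lambda>r. {(1 :: nat, ?b + r + 1), (1, ?b + (3 * k - 1 - r) + 1)}) ` {..<k}"
    unfolding image_image by (intro image_cong) auto
  also have "(\<lambda>j. {(1, ?b + k + j), (1, ?b + 4 * k - j + 1)}) ` Suc ` {..<k} =
      (\<lambda>r. {(1 :: nat, ?b + (k + r) + 1), (1, ?b + (5 * k - 1 - (k + r)) + 1)}) ` {..<k}"
    unfolding image_image by (intro image_cong) auto
  \<comment> \<open>The offset \<open>k + r\<close> becomes the new variable, as in the second
    clause of \<open>piece_chord\<close>.\<close>
  also have "\<dots> = (\<lambda>r. {(1 :: nat, ?b + r + 1), (1, ?b + (5 * k - 1 - r) + 1)}) ` {k..<2 * k}"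
  proof -
    have "{k..<2 * k} = (+) k ` {..<k}"
      by (simp add: lessThan_atLeast0 mult_2)
    then show ?thesis
      by (simp add: image_image)
  qed
  finally show ?thesis
    unfolding piece_chord.simps atLeastLessThan_def atLeast_def lessThan_def by blast
qed

text \<open>Vertex names agree too, so this is an equality of graphs. Positions count from 1 and
  list entries from 0, hence \<open>Suc i\<close>.\<close>

lemma surface_grid_eq_word_grid:
  assumes "Ic \<subseteq> {1..length qs}" "Ih \<subseteq> {1..length qs}"
    and "\<And>i. i < length qs \<Longrightarrow> Suc i \<in> Ic \<longleftrightarrow> qs ! i = Crosscap"
    and "\<And>i. i < length qs \<Longrightarrow> Suc i \<in> Ih \<longleftrightarrow> qs ! i = Handle"
  shows "surface_grid k (length qs) Ic Ih = word_grid k (pieces_word k 0 qs)"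
proof -
  define F where "F i = {{(1 :: nat, 4 * k * i + r + 1), (1 :: nat, 4 * k * i + r' + 1)} | r r'.
    piece_chord k (qs ! i) r r'}" for i
  have Ic: "Ic = Suc ` {i. i < length qs \<and> qs ! i = Crosscap}"
    using assms(1,3) by (auto simp: image_iff) (metis Suc_le_D Suc_le_eq subsetD atLeastAtMost_iff One_nat_def)
  have Ih: "Ih = Suc ` {i. i < length qs \<and> qs ! i = Handle}"
    using assms(2,4) by (auto simp: image_iff) (metis Suc_le_D Suc_le_eq subsetD atLeastAtMost_iff One_nat_def)
  have "(\<Union>i\<in>Ic. crosscap_edges k i) = (\<Union>i\<in>{i. i < length qs \<and> qs ! i = Crosscap}. F i)"
    unfolding Ic by (simp add: crosscap_edges_eq F_def)
  moreover have "(\<Union>i\<in>Ih. handle_edges k i) = (\<Union>i\<in>{i. i < length qs \<and> qs ! i = Handle}. F i)"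
    unfolding Ih by (simp add: handle_edges_eq F_def)
  moreover have "F i = {}" if "qs ! i = Blank" for i
    using that by (simp add: F_def)
  then have "(\<Union>i<length qs. F i) = (\<Union>i\<in>{i. i < length qs \<and> qs ! i = Crosscap}. F i) \<union>
      (\<Union>i\<in>{i. i < length qs \<and> qs ! i = Handle}. F i)"
    using piece.exhaust by blast
  ultimately show ?thesis
    unfolding surface_grid_def word_grid_def chord_grid_def linked_pieces_word length_pieces_word Let_def
    by (simp add: F_def Un_assoc)
qed

text \<open>Position 1 has neither crosscap nor handle, hence the leading \<open>Blank\<close>. It
  later provides the nonempty part to the left of each exchange.\<close>

lemma mixed_surface_grid_word:
  assumes "mixed_surface_grid k c h G"
  obtains qs where "G = word_grid k (pieces_word k 0 (Blank # qs))" "Blank \<notin> set qs"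
    "length qs = c + h" "count_list qs Handle = h"
proof -
  obtain Ic Ih where I: "Ic \<union> Ih = {2..c + h + 1}" "Ic \<inter> Ih = {}" "card Ic = c" "card Ih = h"
    and G: "G = surface_grid k (c + h + 1) Ic Ih"
    using assms unfolding mixed_surface_grid_def by blast
  define qs where "qs = map (\<lambda>i. if i \<in> Ic then Crosscap else Handle) [2..<c + h + 2]"
  have len: "length qs = c + h"
    unfolding qs_def length_map length_upt by simp
  have Ih: "Ih = {i. i < c + h + 2 \<and> 2 \<le> i \<and> i \<notin> Ic}"
    using I(1,2) by (auto simp: set_eq_iff)
  have "count_list qs Handle = length (filter (\<lambda>i. i \<notin> Ic) [2..<c + h + 2])"
    by (auto simp: qs_def count_list_eq_length_filter filter_map comp_def simp del: upt_Suc
        intro!: arg_cong[of _ _ length] filter_cong)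
  also have "\<dots> = card (set (filter (\<lambda>i. i \<notin> Ic) [2..<c + h + 2]))"
    by (rule distinct_card[symmetric]) simp
  also have "set (filter (\<lambda>i. i \<notin> Ic) [2..<c + h + 2]) = Ih"
    unfolding Ih by auto
  finally have cnt: "count_list qs Handle = h"
    using I(4) by simp
  have sub: "Ic \<union> Ih \<subseteq> {1..length (Blank # qs)}"
    unfolding I(1) using len by auto
  have nth: "(Blank # qs) ! i = (if i = 0 then Blank else if Suc i \<in> Ic then Crosscap else Handle)"
    if "i < length (Blank # qs)" for i
    using that len by (cases i) (auto simp: qs_def simp del: upt_Suc)
  have "surface_grid k (length (Blank # qs)) Ic Ih = word_grid k (pieces_word k 0 (Blank # qs))"
  proof (rule surface_grid_eq_word_grid)
    fix i assume i: "i < length (Blank # qs)"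
    have "Suc i \<in> Ic \<union> Ih \<longleftrightarrow> i \<noteq> 0"
      unfolding I(1) using i len by auto
    then show "Suc i \<in> Ic \<longleftrightarrow> (Blank # qs) ! i = Crosscap"
      and "Suc i \<in> Ih \<longleftrightarrow> (Blank # qs) ! i = Handle"
      unfolding nth[OF i] using I(2) by auto
  qed (use sub in simp_all)
  then show ?thesis
    using G len cnt by (intro that[of qs]) (auto simp: qs_def)
qed

text \<open>\<open>C\<close> is the common normal form: \<open>c + h\<close> blocks become
  \<open>2 * h + c\<close> crosscaps, as each of the \<open>h\<close> exchanges adds one
  block.\<close>

lemma mixed_surface_grid_crosscaps:
  assumes "mixed_surface_grid k c h G" "0 < c" "0 < k"
  defines "C \<equiv> \<lambda>j. word_grid j (pieces_word j 0 (Blank # replicate (2 * h + c) Crosscap))"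
  shows "\<lbrakk>0 < j; 17 ^ h * j \<le> k\<rbrakk> \<Longrightarrow> C j \<preceq> G" and "17 ^ h * k \<le> j \<Longrightarrow> G \<preceq> C j"
proof -
  obtain qs where G: "G = word_grid k (pieces_word k 0 (Blank # qs))" and qs: "Blank \<notin> set qs"
    "length qs = c + h" "count_list qs Handle = h"
    using mixed_surface_grid_word[OF assms(1)] .
  have "Crosscap \<in> set qs"
  proof (rule ccontr)
    assume "Crosscap \<notin> set qs"
    then have "Handle = q" if "q \<in> set qs" for q
      using qs(1) that by (cases q) auto
    then have "filter ((=) Handle) qs = qs"
      by (auto simp: filter_id_conv)
    then show False
      using qs(2,3) assms(2) by (simp add: count_list_eq_length_filter)
  qed
  note crosscaps = word_grid_pieces_crosscaps[OF this qs(1,3)]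
  have len: "length qs + h = 2 * h + c"
    using qs(2) by simp
  show "C j \<preceq> G" if "0 < j" "17 ^ h * j \<le> k"
    using crosscaps[OF that] unfolding G C_def len by (rule conjunct1)
  show "G \<preceq> C j" if "17 ^ h * k \<le> j"
    using crosscaps[OF assms(3) that] unfolding G C_def len by (rule conjunct2)
qed

text \<open>Equal values of \<open>2 * h + c\<close> give the same normal form. The comparison
  passes through it at order \<open>17 ^ h * k\<close>: removing the handles of \<open>G\<close>
  costs \<open>17 ^ h\<close>, and those of \<open>H\<close> cost \<open>17 ^ h'\<close>.\<close>

lemma mixed_surface_grid_minor:
  assumes "mixed_surface_grid k c h G" "mixed_surface_grid K c' h' H" "0 < c" "0 < c'" "0 < k"
    and "2 * h + c = 2 * h' + c'" "17 ^ (h + h') * k \<le> K"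
  shows "G \<preceq> H"
proof -
  have "17 ^ h' * (17 ^ h * k) \<le> K"
    using assms(7) by (simp add: power_add ac_simps)
  moreover have "17 ^ h' * 1 \<le> 17 ^ h' * (17 ^ h * k)"
    using assms(5) by (intro mult_le_mono2) (simp add: Suc_le_eq)
  ultimately have "0 < K"
    by (intro gr0I) simp
  show ?thesis
    using mixed_surface_grid_crosscaps(2)[OF assms(1,3,5), of "17 ^ h * k"]
      mixed_surface_grid_crosscaps(1)[OF assms(2,4) \<open>0 < K\<close>, of "17 ^ h * k"]
      \<open>17 ^ h' * (17 ^ h * k) \<le> K\<close> assms(5) minor_trans unfolding assms(6)
    by simp blast
qed

theorem theorem2p3:
  fixes g h c t h0 c0 :: nat
  assumes "c > 0"
    and "g = 2 * h + c"
    and "(c = 2 * t \<and> h0 = t - 1 \<and> c0 = 2) \<or> (c = 2 * t + 1 \<and> h0 = t \<and> c0 = 1)"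
  shows "(\<forall>k>0.
            (\<forall>G. mixed_surface_grid (162 ^ (2 * g) * k) c h G \<longrightarrow>
                 dyck_grid (h + h0) c0 k \<preceq> G) \<and>
            (\<forall>G. mixed_surface_grid k c h G \<longrightarrow>
                 G \<preceq> dyck_grid (h + h0) c0 (162 ^ (2 * g) * k))) \<and>
         (\<forall>X. parametric_graph X \<and> minor_monotone X \<and> (\<forall>k. mixed_surface_grid k c h (X k)) \<longrightarrow>
              linearly_equivalent X (\<lambda>k. dyck_grid (h + h0) c0 k))"
proof -
  let ?D = "dyck_grid (h + h0) c0"
  \<comment> \<open>Both parities give \<open>2 * h0 + c0 = c\<close>. In the even case
    \<open>c > 0\<close> yields \<open>t \<ge> 1\<close>, so \<open>t - 1\<close> is not
    truncated.\<close>
  have genus: "2 * (h + h0) + c0 = 2 * h + c" "0 < c0"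
    using assms by auto
  \<comment> \<open>The exponent counts the handles of both grids together, which is at most
    \<open>2 * g\<close>.\<close>
  have "(17 :: nat) ^ (h + (h + h0)) \<le> 162 ^ (h + (h + h0))"
    by (rule power_mono) simp_all
  also have "\<dots> \<le> 162 ^ (2 * g)"
    using assms by (intro power_increasing) auto
  finally have le: "17 ^ (h + (h + h0)) * k \<le> 162 ^ (2 * g) * k" for k :: nat
    by simp
  have minors: "?D k \<preceq> G" if "0 < k" "mixed_surface_grid (162 ^ (2 * g) * k) c h G" for k G
    by (rule mixed_surface_grid_minor[OF mixed_surface_grid_dyck_grid that(2)])
      (use that(1) genus assms(1) le[of k] in \<open>auto simp: add.commute\<close>)
  have minors': "G \<preceq> ?D (162 ^ (2 * g) * k)" if "0 < k" "mixed_surface_grid k c h G" for k G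
    by (rule mixed_surface_grid_minor[OF that(2) mixed_surface_grid_dyck_grid])
      (use that(1) genus assms(1) le[of k] in auto)
  have "linearly_equivalent X ?D" if X: "\<And>k. mixed_surface_grid k c h (X k)" for X
  proof -
    \<comment> \<open>The comparisons above are for positive order; at order 0 both grids are the
      empty graph.\<close>
    have "X 0 = ?D 0"
      using mixed_surface_grid_0[OF X] mixed_surface_grid_0[OF mixed_surface_grid_dyck_grid] by metis
    then have zero: "X 0 \<preceq> ?D 0" "?D 0 \<preceq> X 0"
      using minor_refl by metis+
    have "X k \<preceq> ?D (162 ^ (2 * g) * k) \<and> ?D k \<preceq> X (162 ^ (2 * g) * k)" for k
    proof (cases "k = 0")
      case True
      then show ?thesis
        using zero by (simp only: mult_0_right)
    next
      case False
      then show ?thesis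
        using minors'[OF _ X] minors[OF _ X] by blast
    qed
    moreover have "linear_function (\<lambda>k. 162 ^ (2 * g) * k)"
      unfolding linear_function_def by blast
    ultimately show ?thesis
      unfolding linearly_equivalent_def by blast
  qed
  then show ?thesis
    using minors minors' by blast
qed

end
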